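(* Let $\lambda$ and $\alpha$ be real numbers with $|\lambda|<\pi\alpha/2<\pi/2$. For a domain $\Omega$ in $\mathbb{C}$ with $0\in\Omega$, each of the following conditions implies the others: (i) There exists a strongly $\lambda$-spirallike function $f$ of order $\alpha$ such that $\Omega=f(\mathbb{D})$. (ii) The radius function $R_\lambda$ of $\Omega$ with respect to $\lambda$-spirals is bounded, absolutely continuous on $[0,2\pi]$ and satisfies $$\left|\frac{R_\lambda'(\theta)}{R_\lambda(\theta)}+\sin\lambda\cos\lambda\right|\le\cos^2\lambda\,\tan\frac{\pi\alpha}{2}$$ for almost every $\theta$. (iii) $wU_{\lambda,\alpha}\subset\Omega$ whenever $w\in\partial\Omega$. (iv) $wU_{\lambda,\alpha}\subset\Omega$ whenever $w\in\Omega$.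
   Context: $\mathbb{D}=\{z\in\mathbb{C}:|z|<1\}$; $\partial\Omega$ is the boundary of $\Omega$ in $\mathbb{C}$; $wU=\{wu:u\in U\}$. Strongly spirallike functions: for $\lambda\in(-\pi/2,\pi/2)$ and $\alpha\in(0,1)$, an analytic function $f$ on $\mathbb{D}$ is strongly $\lambda$-spirallike of order $\alpha$ if $f(0)=0$, $f$ is non-constant, and $\left|\arg\frac{zf'(z)}{f(z)}-\lambda\right|<\frac{\pi\alpha}{2}$ for all $z\in\mathbb{D}$. Here $zf'(z)/f(z)$ is understood to take the value $1$ at $z=0$ (so $f'(0)\neq0$), and the condition means that $zf'(z)/f(z)$ lies in the open sector $\{se^{i\phi}:s>0,\ |\phi-\lambda|<\pi\alpha/2\}$ for every $z\in\mathbb{D}$. Spiral coordinates: for $r>0$, $\theta\in\mathbb{R}$ put $P_\lambda(r,\theta)=re^{i(\theta+\tan\lambda\cdot\log r)}=\exp[(1+i\tan\lambda)\log r+i\theta]$, and $P_\lambda(0,\theta)=0$. For $w\in\mathbb{C}$, $w\neq0$, the $\lambda$-spiral segment is $[0,w]_\lambda=\{w\exp(e^{i\lambda}t):t<0\}\cup\{0\}$. Radius function: for a domain $\Omega\subset\mathbb{C}$ with $0\in\Omega$, the radius function of $\Omega$ with respect to $\lambda$-spirals is the $2\pi$-periodic function $R_\lambda:\mathbb{R}\to(0,+\infty]$ given by $R_\lambda(\theta)=\sup\{r>0:[0,P_\lambda(r,\theta)]_\lambda\subset\Omega\}$. Standard domain: with $$A=\cos^2\lambda\left(\tan\tfrac{\pi\alpha}{2}-\tan\lambda\right)>0,\qquad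 B=-\cos^2\lambda\left(\tan\tfrac{\pi\alpha}{2}+\tan\lambda\right)<0,$$ set $$U_{\lambda,\alpha}=\{P_\lambda(r,\theta):0\le\theta<2\pi,\ 0\le r<\max\{e^{B\theta},e^{-A(2\pi-\theta)}\}\}.$$
   Formalization: As stated the claim fails for Ω = ℂ ((iii),(iv) hold, (i),(ii) fail) and for Ω = ℂ∖{1} ((iii) holds, the rest fail); so (iv)⇒(i) is proved for Ω ≠ ℂ and (iii)⇒(i) for Ω with unbounded complement; (i)⇔(ii), (i)⇒(iv), (iv)⇒(iii) hold for all Ω. *)

theory Defs
  imports "HOL-Complex_Analysis.Complex_Analysis"
begin

definition sector :: "real \<Rightarrow> real \<Rightarrow> complex set" where
  "sector lam \<delta> = {of_real s * cis \<phi> | s \<phi>. s > 0 \<and> \<bar>\<phi> - lam\<bar> < \<delta>}"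

(* The condition deriv f 0 \<noteq> 0 makes 1 the actual limit of z f'(z) / f(z) at 0; at a zero
   of higher order the limit would be that order. A zero of f other than 0 is excluded by the
   sector condition, because there the quotient is 0 (division by zero). *)
definition strongly_spirallike :: "real \<Rightarrow> real \<Rightarrow> (complex \<Rightarrow> complex) \<Rightarrow> bool" where
  "strongly_spirallike lam al f \<longleftrightarrow>
     f holomorphic_on ball 0 1 \<and> f 0 = 0 \<and> \<not> f constant_on ball 0 1 \<and> deriv f 0 \<noteq> 0 \<and>
     (\<forall>z\<in>ball 0 1. (if z = 0 then 1 else z * deriv f z / f z) \<in> sector lam (pi * al / 2))"

(* Used for r \<ge> 0 only; at r = 0 the factor of_real r gives the value 0. *)
definition spiral_point :: "real \<Rightarrow> real \<Rightarrow> real \<Rightarrow> complex" where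
  "spiral_point lam r \<theta> = of_real r * cis (\<theta> + tan lam * ln r)"

definition spiral_segment :: "real \<Rightarrow> complex \<Rightarrow> complex set" where
  "spiral_segment lam w = insert 0 {w * exp (cis lam * of_real t) | t. t < 0}"

definition radius_fun :: "real \<Rightarrow> complex set \<Rightarrow> real \<Rightarrow> ereal" where
  "radius_fun lam \<Omega> \<theta> =
     Sup {ereal r | r. r > 0 \<and> spiral_segment lam (spiral_point lam r \<theta>) \<subseteq> \<Omega>}"

definition standard_domain :: "real \<Rightarrow> real \<Rightarrow> complex set" where
  "standard_domain lam al =
     (let A = (cos lam)\<^sup>2 * (tan (pi * al / 2) - tan lam);
          B = - ((cos lam)\<^sup>2 * (tan (pi * al / 2) + tan lam))
      in {spiral_point lam r \<theta> | r \<theta>.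
            0 \<le> \<theta> \<and> \<theta> < 2 * pi \<and> 0 \<le> r \<and> r < max (exp (B * \<theta>)) (exp (- A * (2 * pi - \<theta>)))})"

definition absolutely_continuous_fun_on :: "real \<Rightarrow> real \<Rightarrow> (real \<Rightarrow> real) \<Rightarrow> bool" where
  "absolutely_continuous_fun_on a b g \<longleftrightarrow>
     (\<forall>\<epsilon>>0. \<exists>\<delta>>0. \<forall>(n::nat) x y.
        (\<forall>k<n. a \<le> x k \<and> x k \<le> y k \<and> y k \<le> b) \<and>
        (\<forall>j<n. \<forall>k<n. j \<noteq> k \<longrightarrow> {x j<..<y j} \<inter> {x k<..<y k} = {}) \<and>
        (\<Sum>k<n. y k - x k) < \<delta>
        \<longrightarrow> (\<Sum>k<n. \<bar>g (y k) - g (x k)\<bar>) < \<epsilon>)"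

(* Boundedness forces all values of the radius function to be finite, so that passing to
   real_of_ereal afterwards loses nothing. *)
definition radius_condition :: "real \<Rightarrow> real \<Rightarrow> complex set \<Rightarrow> bool" where
  "radius_condition lam al \<Omega> \<longleftrightarrow>
     (let R = (\<lambda>\<theta>. real_of_ereal (radius_fun lam \<Omega> \<theta>))
      in (\<exists>M::real. \<forall>\<theta>. radius_fun lam \<Omega> \<theta> \<le> ereal M) \<and>
         absolutely_continuous_fun_on 0 (2 * pi) R \<and>
         (AE \<theta> in lebesgue. \<exists>D. (R has_real_derivative D) (at \<theta>) \<and>
            \<bar>D / R \<theta> + sin lam * cos lam\<bar> \<le> (cos lam)\<^sup>2 * tan (pi * al / 2)))"

end

theory Submission
  imports Defs
begin

text \<open>
  Write \<open>\<beta> = \<pi> \<alpha> / 2\<close>, \<open>\<mu>\<^sub>1 = \<lambda> - (\<pi>/2 - \<beta>)\<close> and \<open>\<mu>\<^sub>2 = \<lambda> + (\<pi>/2 - \<beta>)\<close>. The sector of half-opening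
  \<open>\<beta>\<close> around the direction \<open>\<lambda>\<close> is the intersection of the half planes \<open>Re (cis (- \<mu>) p) > 0\<close> for
  \<open>\<mu> = \<mu>\<^sub>1, \<mu>\<^sub>2\<close>, so a strongly spirallike function is the same thing as a function that is spirallike
  in the ordinary sense for both angles. In logarithmic coordinates the standard domain without the
  origin is the image under \<open>exp\<close> of the open convex cone spanned by \<open>- cis \<mu>\<^sub>1\<close> and \<open>- cis \<mu>\<^sub>2\<close>
  (\<open>standard_domain_eq\<close>). Hence \<open>c4\<close> says that \<open>\<Omega>\<close> is invariant under multiplication by \<open>exp c\<close> for
  all \<open>c\<close> in this cone; call such a set cone invariant. Both \<open>c1\<close> and \<open>c2\<close> are shown to be equivalent
  to the conjunction of cone invariance and \<open>\<Omega> \<noteq> UNIV\<close>.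

  From \<open>c1\<close>: the compact sets \<open>f (cball 0 r)\<close> are invariant under multiplication by
  \<open>exp (- t cis \<mu>)\<close>, because the curve that starts at a point of \<open>f (sphere 0 r)\<close> is lifted by the
  local inverse of \<open>f\<close> into the smaller disc (\<open>spirallike_image_invariant\<close>). Moreover \<open>f\<close> is
  injective, as the derivative of \<open>\<zeta> \<mapsto> log f (exp \<zeta>)\<close> stays in a half plane
  (\<open>strongly_spirallike_inj\<close>), and a univalent image of the disc is not the whole plane by
  Liouville's theorem. To \<open>c1\<close>: a cone invariant \<open>\<Omega> \<noteq> UNIV\<close> contracts to \<open>0\<close> along spirals, hence
  is the image of a Riemann map \<open>f\<close> with \<open>f 0 = 0\<close>. The Schwarz lemma, applied to
  \<open>z \<mapsto> f\<^sup>-\<^sup>1 (f z exp (- t cis \<mu>))\<close>, gives the half plane condition after differentiation at \<open>t = 0\<close>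
  (\<open>spirallike_of_image_invariant\<close>).

  For \<open>c2\<close>: let \<open>\<phi>\<close> be the logarithm of the radius function \<open>R\<close>. Cone invariance means
  \<open>\<phi> (\<theta> + h) \<ge> \<phi> \<theta> + min (A h) (B h)\<close>, that is, all difference quotients of \<open>\<phi>\<close> lie in \<open>[B, A]\<close>. Then
  \<open>\<phi>\<close> is Lipschitz, hence differentiable almost everywhere (\<open>lipschitz_ae_differentiable\<close>), and
  \<open>R' / R = \<phi>'\<close> obeys the required bound. Conversely, an absolutely continuous function with
  nonnegative derivative almost everywhere is nondecreasing (\<open>absolutely_continuous_nondecreasing\<close>);
  applied to \<open>\<phi> \<theta> - B \<theta>\<close> and \<open>A \<theta> - \<phi> \<theta>\<close> it bounds the difference quotients. As \<open>\<phi>\<close> is then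
  continuous and its graph avoids \<open>\<Omega>\<close>, connectedness forces \<open>\<Omega>\<close> to be the region below the graph.

  For \<open>c3\<close>: cone invariance passes to the frontier because the cone is open. In the other direction,
  an unbounded frontier would give \<open>\<Omega> = UNIV\<close>, because the standard domain contains a disc around \<open>0\<close>.
  With a bounded frontier and an unbounded complement, \<open>\<Omega>\<close> is bounded; the outward spiral from each
  nonzero point of \<open>\<Omega>\<close> then meets the frontier, from which that point inherits the invariance.
\<close>

section \<open>Lipschitz functions are differentiable almost everywhere\<close>

text \<open>Lebesgue's differentiation theorem on an interval. A point where the derivative fails to be \<open>g x\<close>
  lies in arbitrarily short intervals on which \<open>F\<close> and \<open>g x\<close> times the length differ by a fixed
  proportion of the length. Vitali's theorem extracts disjoint such intervals that cover almost all
  bad points, and Henstock's lemma bounds their total length by an arbitrarily small number.\<close>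
lemma indefinite_integral_ae_derivative:
  fixes g F :: "real \<Rightarrow> real"
  assumes int: "\<And>u v. a \<le> u \<Longrightarrow> u \<le> v \<Longrightarrow> v \<le> b \<Longrightarrow> (g has_integral (F v - F u)) {u..v}"
  shows "negligible {x \<in> {a<..<b}. \<not> (F has_real_derivative g x) (at x)}"
proof (cases "a < b")
  case ab: True
  define bad where "bad m x u v \<longleftrightarrow> u < v \<and> (u = x \<or> v = x) \<and> {u..v} \<subseteq> {a<..<b} \<and>
      v - u \<le> real (Suc m) * \<bar>(v - u) * g x - (F v - F u)\<bar>" for m :: nat and x u v
  define S where "S m = {x \<in> {a<..<b}. \<forall>d>0. \<exists>u v. v - u < d \<and> bad m x u v}" for m
  have neg: "negligible (S m)" for m
    unfolding negligible_outer_le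
  proof (intro allI impI)
    fix e :: real assume e: "e > 0"
    have "g integrable_on cbox a b" using int[of a b] ab by auto
    moreover have "e / real (Suc m) > 0" using e by simp
    ultimately obtain \<gamma> where \<gamma>: "gauge \<gamma>"
      and hen: "\<And>p. p tagged_partial_division_of (cbox a b) \<Longrightarrow> \<gamma> fine p \<Longrightarrow>
             sum (\<lambda>(x,k). norm (measure lborel k *\<^sub>R g x - integral k g)) p < e / real (Suc m)"
      by (rule Henstock_lemma) blast
    define K where "K = {(x,u,v). x \<in> {a<..<b} \<and> bad m x u v \<and> {u..v} \<subseteq> \<gamma> x}"
    define c r where "c = (\<lambda>(x::real,u::real,v::real). (u + v) / 2)"
      and "r = (\<lambda>(x::real,u::real,v::real). (v - u) / 2)"
    have cb: "cball (c i) (r i) = {fst (snd i)..snd (snd i)}" for i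
      by (auto simp: c_def r_def dist_real_def split: prod.splits) (auto simp: field_simps abs_if split: if_splits)
    have "\<exists>i. i \<in> K \<and> x \<in> cball (c i) (r i) \<and> r i < d" if x: "x \<in> S m" and d: "0 < d" for x d
    proof -
      from \<gamma> obtain \<rho> where \<rho>: "\<rho> > 0" "ball x \<rho> \<subseteq> \<gamma> x"
        unfolding gauge_def by (meson open_contains_ball)
      from x have "\<forall>d>0. \<exists>u v. v - u < d \<and> bad m x u v" by (simp add: S_def)
      then obtain u v where uv: "v - u < min d \<rho>" "bad m x u v"
        using d \<rho>(1) by (metis min_less_iff_conj)
      have "{u..v} \<subseteq> ball x \<rho>" using uv by (auto simp: bad_def dist_real_def)
      then have "(x,u,v) \<in> K" using uv \<rho> x by (auto simp: K_def S_def)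
      moreover have "x \<in> cball (c (x,u,v)) (r (x,u,v))" unfolding cb using uv by (auto simp: bad_def)
      moreover have "r (x,u,v) < d" using uv d by (auto simp: r_def bad_def)
      ultimately show ?thesis by blast
    qed
    note cover = this
    obtain C where C: "countable C" "C \<subseteq> K"
        "pairwise (\<lambda>i j. disjnt (cball (c i) (r i)) (cball (c j) (r j))) C"
        "negligible (S m - (\<Union>i \<in> C. cball (c i) (r i)))"
    proof (rule Vitali_covering_theorem_cballs[of K r "S m" c])
      show "0 < r i" if "i \<in> K" for i using that by (auto simp: K_def bad_def r_def)
    qed (use cover in blast)+
    \<comment> \<open>By disjointness the measure is the sum of the lengths, and Henstock's lemma applies to the
        intervals of \<open>D\<close>, tagged by their bad end points.\<close>
    have bound: "measure lebesgue (\<Union>i\<in>D. cball (c i) (r i)) \<le> e" if D: "D \<subseteq> C" "finite D" for D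
    proof -
      define q where "q = (\<lambda>(x::real,u::real,v::real). (x,{u..v}))"
      have uvK: "u < v" "x \<in> {u..v}" "{u..v} \<subseteq> {a..b}" "{u..v} \<subseteq> \<gamma> x"
          "v - u \<le> real (Suc m) * \<bar>(v - u) * g x - (F v - F u)\<bar>"
        if "(x,u,v) \<in> D" for x u v
      proof -
        have *: "bad m x u v" "{u..v} \<subseteq> \<gamma> x" using that D C(2) by (auto simp: K_def)
        show "u < v" "x \<in> {u..v}" "{u..v} \<subseteq> \<gamma> x"
          "v - u \<le> real (Suc m) * \<bar>(v - u) * g x - (F v - F u)\<bar>"
          using * unfolding bad_def by auto
        have "{a<..<b} \<subseteq> {a..b}" by auto
        then show "{u..v} \<subseteq> {a..b}" using * unfolding bad_def by (meson order_trans)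
      qed
      have disj: "{u..v} \<inter> {u'..v'} = {}"
        if "(x,u,v) \<in> D" "(x',u',v') \<in> D" "(x,u,v) \<noteq> (x',u',v')" for x u v x' u' v'
      proof -
        have "(x,u,v) \<in> C" "(x',u',v') \<in> C" using that D by auto
        from pairwiseD[OF C(3) this that(3)] show ?thesis by (simp add: cb disjnt_def)
      qed
      have inj: "inj_on q D"
        unfolding inj_on_def q_def by (auto dest!: uvK(1))
      have "q ` D tagged_partial_division_of (cbox a b)"
        unfolding tagged_partial_division_of_def
      proof (intro conjI allI impI)
        show "finite (q ` D)" using D by simp
      next
        fix x k assume "(x, k) \<in> q ` D"
        then obtain u v where uv: "(x,u,v) \<in> D" "k = {u..v}" by (auto simp: q_def)
        show "x \<in> k" "k \<subseteq> cbox a b" "\<exists>a b. k = cbox a b"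
          using uvK[OF uv(1)] uv(2) by auto
      next
        fix x1 k1 x2 k2
        assume "(x1, k1) \<in> q ` D \<and> (x2, k2) \<in> q ` D \<and> (x1, k1) \<noteq> (x2, k2)"
        then have k12: "(x1, k1) \<in> q ` D" "(x2, k2) \<in> q ` D" "(x1, k1) \<noteq> (x2, k2)" by auto
        from k12(1) obtain u1 v1 where 1: "(x1,u1,v1) \<in> D" "k1 = {u1..v1}" by (auto simp: q_def)
        from k12(2) obtain u2 v2 where 2: "(x2,u2,v2) \<in> D" "k2 = {u2..v2}" by (auto simp: q_def)
        have "(x1,u1,v1) \<noteq> (x2,u2,v2)" using k12(3) 1 2 by auto
        then have "k1 \<inter> k2 = {}" using disj[OF 1(1) 2(1)] 1 2 by auto
        then show "interior k1 \<inter> interior k2 = {}" by (metis interior_Int interior_empty)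
      qed
      moreover have "\<gamma> fine (q ` D)"
        unfolding fine_def q_def using uvK(4) by auto
      ultimately have lt: "sum (\<lambda>(x,k). norm (measure lborel k *\<^sub>R g x - integral k g)) (q ` D) < e / real (Suc m)"
        by (rule hen)
      have "measure lebesgue (\<Union>i\<in>D. cball (c i) (r i)) = (\<Sum>i\<in>D. measure lebesgue (cball (c i) (r i)))"
        using D C(3) by (intro measure_UNION') (auto intro: pairwise_mono)
      also have "\<dots> = (\<Sum>(x,u,v)\<in>D. v - u)"
        unfolding cb
      proof (intro sum.cong refl)
        fix i assume "i \<in> D"
        then have "fst (snd i) \<le> snd (snd i)" using uvK(1)[of "fst i" "fst (snd i)" "snd (snd i)"] by simp
        then show "measure lebesgue {fst (snd i)..snd (snd i)} = (case i of (x, u, v) \<Rightarrow> v - u)"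
          by (simp add: split_def)
      qed
      also have "\<dots> \<le> (\<Sum>(x,u,v)\<in>D. real (Suc m) * \<bar>(v - u) * g x - (F v - F u)\<bar>)"
        using uvK(5) by (intro sum_mono) auto
      also have "\<dots> = (\<Sum>i\<in>D. real (Suc m) * (case q i of (x,k) \<Rightarrow> norm (measure lborel k *\<^sub>R g x - integral k g)))"
      proof (rule sum.cong, simp)
        fix i assume i: "i \<in> D"
        obtain x u v where ieq: "i = (x,u,v)" by (cases i)
        note uv = uvK[OF i[unfolded ieq]]
        have "integral {u..v} g = F v - F u"
          using int[of u v] uv by (intro integral_unique) auto
        then show "(case i of (x, u, v) \<Rightarrow> real (Suc m) * \<bar>(v - u) * g x - (F v - F u)\<bar>) =
           real (Suc m) * (case q i of (x,k) \<Rightarrow> norm (measure lborel k *\<^sub>R g x - integral k g))"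
          using uv(1) by (simp add: ieq q_def)
      qed
      also have "\<dots> = real (Suc m) * sum (\<lambda>(x,k). norm (measure lborel k *\<^sub>R g x - integral k g)) (q ` D)"
        by (simp add: sum.reindex[OF inj] sum_distrib_left)
      also have "\<dots> \<le> real (Suc m) * (e / real (Suc m))"
        using lt by (intro mult_left_mono) auto
      finally show ?thesis by simp
    qed
    define T where "T = (\<Union>i\<in>C. cball (c i) (r i)) \<union> (S m - (\<Union>i \<in> C. cball (c i) (r i)))"
    have U: "(\<Union>i\<in>C. cball (c i) (r i)) \<in> lmeasurable" "measure lebesgue (\<Union>i\<in>C. cball (c i) (r i)) \<le> e"
      using fmeasurable_UN_bound[OF C(1) _ bound] measure_UN_bound[OF C(1) _ bound] by auto
    have "T \<in> lmeasurable" unfolding T_def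
      using U(1) negligible_imp_measurable[OF C(4)] by (rule fmeasurable.Un)
    moreover have "measure lebesgue T = measure lebesgue (\<Union>i\<in>C. cball (c i) (r i))"
      unfolding T_def using C(4) U(1)
      by (intro measure_Un_null_set) (simp_all add: negligible_iff_null_sets fmeasurableD)
    ultimately show "\<exists>T. S m \<subseteq> T \<and> T \<in> lmeasurable \<and> measure lebesgue T \<le> e"
      using U by (intro exI[of _ T]) (auto simp: T_def)
  qed
  have "{x \<in> {a<..<b}. \<not> (F has_real_derivative g x) (at x)} \<subseteq> (\<Union>m. S m)"
  proof
    fix x assume x: "x \<in> {x \<in> {a<..<b}. \<not> (F has_real_derivative g x) (at x)}"
    then have "\<not> ((\<lambda>y. (F y - F x) / (y - x)) \<longlongrightarrow> g x) (at x)"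
      by (simp add: has_field_derivative_iff)
    then obtain \<epsilon> where \<epsilon>: "\<epsilon> > 0" and
      far: "\<And>d. d > 0 \<Longrightarrow> \<exists>y. y \<noteq> x \<and> dist y x < d \<and> \<not> dist ((F y - F x) / (y - x)) (g x) < \<epsilon>"
      unfolding Lim_at by (metis zero_less_dist_iff)
    obtain m where m: "1 / real (Suc m) < \<epsilon>" using \<epsilon> nat_approx_posE by blast
    have "x \<in> S m" unfolding S_def
    proof (intro CollectI conjI allI impI)
      show "x \<in> {a<..<b}" using x by simp
      fix d :: real assume "d > 0"
      with x have "min d (min (x - a) (b - x)) > 0" by auto
      from far[OF this] obtain y where y: "y \<noteq> x" "dist y x < d" "dist y x < x - a" "dist y x < b - x"
          "\<epsilon> \<le> dist ((F y - F x) / (y - x)) (g x)" by auto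
      have "(F y - F x) / (y - x) - g x = ((F y - F x) - (y - x) * g x) / (y - x)"
        using y(1) by (simp add: field_simps)
      then have "\<epsilon> * \<bar>y - x\<bar> \<le> \<bar>(y - x) * g x - (F y - F x)\<bar>"
        using y(1,5) by (simp add: dist_real_def abs_divide field_simps abs_minus_commute)
      moreover have "\<bar>y - x\<bar> \<le> real (Suc m) * (\<epsilon> * \<bar>y - x\<bar>)"
      proof -
        have "1 * \<bar>y - x\<bar> \<le> (real (Suc m) * \<epsilon>) * \<bar>y - x\<bar>"
          using m by (intro mult_right_mono) (auto simp: field_simps)
        then show ?thesis by (simp add: mult.assoc)
      qed
      ultimately have key: "\<bar>y - x\<bar> \<le> real (Suc m) * \<bar>(y - x) * g x - (F y - F x)\<bar>"
        by (meson mult_left_mono of_nat_0_le_iff order_trans)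
      define u v where "u = min x y" and "v = max x y"
      have "\<bar>(v - u) * g x - (F v - F u)\<bar> = \<bar>(y - x) * g x - (F y - F x)\<bar>"
        by (cases "x \<le> y") (auto simp: u_def v_def algebra_simps abs_if)
      with key have "bad m x u v" unfolding bad_def
        using y by (auto simp: u_def v_def dist_real_def abs_if split: if_splits)
      moreover have "v - u < d" using y by (auto simp: u_def v_def dist_real_def)
      ultimately show "\<exists>u v. v - u < d \<and> bad m x u v" by blast
    qed
    then show "x \<in> (\<Union>m. S m)" by blast
  qed
  then show ?thesis using neg by (meson negligible_Union_nat negligible_subset)
qed auto

text \<open>Rademacher's theorem in dimension one. Adding a suitable linear function to \<open>f\<close> gives an
  increasing bi-Lipschitz function \<open>F\<close>; the pullback of Lebesgue measure under \<open>F\<close> is then absolutely continuous, so \<open>F\<close> is the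
  indefinite integral of a Radon-Nikodym density.\<close>
lemma lipschitz_ae_differentiable:
  fixes f :: "real \<Rightarrow> real"
  assumes lip: "\<And>x y. \<bar>f x - f y\<bar> \<le> L * \<bar>x - y\<bar>"
  shows "AE x in lebesgue. \<exists>D. (f has_real_derivative D) (at x)"
proof -
  have L: "L \<ge> 0" using lip[of 1 0] by simp
  define F where "F x = f x + (L + 1) * x" for x
  \<comment> \<open>The summand \<open>(L + 1) * x\<close> outweighs the possible decrease of \<open>f\<close>.\<close>
  have lower: "F y - F x \<ge> y - x" and upper: "F y - F x \<le> (2 * L + 1) * (y - x)" if "x \<le> y" for x y
    using lip[of y x] that by (auto simp: F_def algebra_simps abs_le_iff)
  have Flip: "\<bar>F y - F x\<bar> \<le> (2 * L + 1) * \<bar>y - x\<bar>" for x y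
  proof (cases "x \<le> y")
    case True then show ?thesis using lower[OF True] upper[OF True] by simp
  next
    case False
    then have "y \<le> x" by simp
    then show ?thesis using lower[of y x] upper[of y x] by simp
  qed
  have contF: "continuous_on UNIV F"
    using Flip by (intro lipschitz_on_continuous_on[of "2 * L + 1"] lipschitz_onI) (use L in \<open>auto simp: dist_real_def\<close>)
  have Fsm: "F x < F y" if "x < y" for x y using lower[of x y] that by simp
  have Fle: "F x \<le> F y \<longleftrightarrow> x \<le> y" for x y using Fsm[of x y] Fsm[of y x] by (cases x y rule: linorder_cases) auto
  have surj: "\<exists>x. F x = y" for y
  proof -
    define t where "t = \<bar>y - F 0\<bar>"
    have t: "- t \<le> t" by (simp add: t_def)
    have "F (- t) \<le> y" "y \<le> F t" using lower[of "-t" 0] lower[of 0 t] by (auto simp: t_def)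
    then show ?thesis
      using IVT'[of F "-t" y t, OF _ _ t continuous_on_subset[OF contF]] by blast
  qed
  define G where "G = inv F"
  have FG: "F (G y) = y" for y unfolding G_def using surj by (metis f_inv_into_f rangeI)
  have GF: "G (F x) = x" for x using Fle FG by (metis order_antisym order_refl)
  have "mono G" unfolding mono_def using Fle FG by metis
  then have [measurable]: "G \<in> borel_measurable borel" by (rule borel_measurable_mono)
  have vim: "G -` S = F ` S" for S using FG GF by (auto simp: image_iff) (metis FG)+
  have FIcc: "F ` {u..v} = {F u..F v}" for u v
    unfolding vim[symmetric] using Fle FG by (auto) (metis)+
  define \<mu> where "\<mu> = distr lborel borel G"
  have \<mu>: "emeasure \<mu> S = emeasure lborel (F ` S)" if "S \<in> sets borel" for S
    unfolding \<mu>_def using that by (simp add: emeasure_distr vim)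
  \<comment> \<open>The measure of a set is that of its image under \<open>F\<close>, and Lipschitz maps preserve null sets.\<close>
  have "absolutely_continuous lborel \<mu>"
    unfolding absolutely_continuous_def
  proof
    fix S :: "real set" assume S: "S \<in> null_sets lborel"
    then have Sb: "S \<in> sets borel" by (auto simp: null_sets_def)
    have "negligible S" using S by (simp add: negligible_iff_null_sets null_sets_completionI)
    then have "negligible (F ` S)"
      using Flip by (intro negligible_locally_Lipschitz_image) (auto intro!: exI[of _ UNIV] exI[of _ "2 * L + 1"])
    then have "F ` S \<in> null_sets lebesgue" by (simp add: negligible_iff_null_sets)
    moreover have "F ` S \<in> sets borel"
      using measurable_sets[OF \<open>G \<in> borel_measurable borel\<close> Sb] by (simp add: vim)
    ultimately have "emeasure lborel (F ` S) = 0" by (auto simp: null_sets_def)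
    then show "S \<in> null_sets \<mu>" using \<mu>[OF Sb] Sb by (auto simp: null_sets_def \<mu>_def)
  qed
  moreover have "sets \<mu> = sets lborel" by (simp add: \<mu>_def)
  ultimately obtain h where h[measurable]: "h \<in> borel_measurable lborel" and dens: "density lborel h = \<mu>"
    using sigma_finite_measure.Radon_Nikodym[OF sigma_finite_lborel] by blast
  have hI: "(\<integral>\<^sup>+x. h x * indicator {u..v} x \<partial>lborel) = ennreal (F v - F u)" if "u \<le> v" for u v
  proof -
    have "(\<integral>\<^sup>+x. h x * indicator {u..v} x \<partial>lborel) = emeasure \<mu> {u..v}"
      unfolding dens[symmetric] by (subst emeasure_density) auto
    also have "\<dots> = ennreal (F v - F u)" using that Fle by (simp add: \<mu> FIcc)
    finally show ?thesis .
  qed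
  have fin: "AE x in lborel. h x \<noteq> \<infinity>"
  proof -
    have "AE x in lborel. \<forall>n::nat. h x * indicator {- real n..real n} x \<noteq> \<infinity>"
      unfolding AE_all_countable
    proof
      fix n :: nat
      show "AE x in lborel. h x * indicator {- real n..real n} x \<noteq> \<infinity>"
        by (rule nn_integral_PInf_AE) (auto simp: hI)
    qed
    then show ?thesis
    proof eventually_elim
      case (elim x)
      obtain n where "\<bar>x\<bar> \<le> real n" using real_arch_simple by blast
      then have "x \<in> {- real n..real n}" by auto
      then show ?case using elim[THEN spec, of n] by simp
    qed
  qed
  define g where "g x = enn2real (h x)" for x
  have gI: "(g has_integral (F v - F u)) {u..v}" if uv: "u \<le> v" for u v
  proof -
    have "((\<lambda>x. g x * indicator {u..v} x) has_integral (F v - F u)) UNIV"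
    proof (rule nn_integral_has_integral)
      have "(\<integral>\<^sup>+x. ennreal (g x * indicator {u..v} x) \<partial>lborel) = (\<integral>\<^sup>+x. h x * indicator {u..v} x \<partial>lborel)"
      proof (rule nn_integral_cong_AE)
        show "AE x in lborel. ennreal (g x * indicator {u..v} x) = h x * indicator {u..v} x"
          using fin by eventually_elim (auto simp: g_def indicator_def less_top)
      qed
      then show "(\<integral>\<^sup>+x. ennreal (g x * indicator {u..v} x) \<partial>lborel) = ennreal (F v - F u)"
        using hI[OF uv] by simp
    qed (use Fle uv in \<open>auto simp: g_def\<close>)
    moreover have "(\<lambda>x. g x * indicator {u..v} x) = (\<lambda>x. if x \<in> {u..v} then g x else 0)"
      by (auto simp: indicator_def)
    ultimately show ?thesis using has_integral_restrict_UNIV[of "{u..v}" g] by simp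
  qed
  have "negligible (\<Union>n. {x \<in> {- real n<..<real n}. \<not> (F has_real_derivative g x) (at x)})"
    by (intro negligible_Union_nat indefinite_integral_ae_derivative gI)
  moreover have "{x. \<not> (\<exists>D. (f has_real_derivative D) (at x))} \<subseteq>
      (\<Union>n. {x \<in> {- real n<..<real n}. \<not> (F has_real_derivative g x) (at x)})"
  proof
    fix x assume x: "x \<in> {x. \<not> (\<exists>D. (f has_real_derivative D) (at x))}"
    obtain n where "\<bar>x\<bar> < real n" using reals_Archimedean2 by blast
    moreover have "\<not> (F has_real_derivative g x) (at x)"
    proof
      assume "(F has_real_derivative g x) (at x)"
      then have "((\<lambda>x. F x - (L + 1) * x) has_real_derivative g x - (L + 1)) (at x)"
        by (auto intro!: derivative_eq_intros)
      then show False using x by (auto simp: F_def)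
    qed
    ultimately show "x \<in> (\<Union>n. {x \<in> {- real n<..<real n}. \<not> (F has_real_derivative g x) (at x)})"
      by (auto simp: abs_less_iff intro!: exI[of _ n])
  qed
  ultimately have "negligible {x. \<not> (\<exists>D. (f has_real_derivative D) (at x))}"
    by (rule negligible_subset)
  then have "{x. \<not> (\<exists>D. (f has_real_derivative D) (at x))} \<in> null_sets lebesgue"
    by (simp add: negligible_iff_null_sets)
  then show ?thesis by (rule AE_I') auto
qed

section \<open>Absolutely continuous functions with nonnegative derivative\<close>

text \<open>The proof compares Riemann sums over a tagged division that is fine for a suitable gauge: around
  points outside \<open>N\<close> the gauge controls the difference quotients, and the intervals with tags in \<open>N\<close>
  have small total length, so absolute continuity makes their contribution small.\<close>
lemma absolutely_continuous_nondecreasing: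
  fixes g :: "real \<Rightarrow> real"
  assumes ac: "absolutely_continuous_fun_on a b g" and ab: "a \<le> b"
    and N: "negligible N"
    and deriv: "\<And>x. x \<in> {a..b} - N \<Longrightarrow> \<exists>D\<ge>0. (g has_real_derivative D) (at x)"
  shows "g a \<le> g b"
proof (rule field_le_epsilon)
  fix e :: real assume e: "e > 0"
  define e1 where "e1 = e / (2 * (b - a + 1))"
  have e1: "e1 > 0" "e1 * (b - a) \<le> e / 2" using e ab by (auto simp: e1_def field_simps)
  have "\<exists>\<delta>>0. \<forall>(n::nat) x y.
        (\<forall>k<n. a \<le> x k \<and> x k \<le> y k \<and> y k \<le> b) \<and>
        (\<forall>j<n. \<forall>k<n. j \<noteq> k \<longrightarrow> {x j<..<y j} \<inter> {x k<..<y k} = {}) \<and>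
        (\<Sum>k<n. y k - x k) < \<delta> \<longrightarrow> (\<Sum>k<n. \<bar>g (y k) - g (x k)\<bar>) < e / 2"
    using ac[unfolded absolutely_continuous_fun_on_def, THEN spec, of "e / 2"] e by simp
  then obtain \<delta> where \<delta>0: "\<delta> > 0 \<and> (\<forall>(n::nat) x y.
        (\<forall>k<n. a \<le> x k \<and> x k \<le> y k \<and> y k \<le> b) \<and>
        (\<forall>j<n. \<forall>k<n. j \<noteq> k \<longrightarrow> {x j<..<y j} \<inter> {x k<..<y k} = {}) \<and>
        (\<Sum>k<n. y k - x k) < \<delta> \<longrightarrow> (\<Sum>k<n. \<bar>g (y k) - g (x k)\<bar>) < e / 2)"
    by (rule exE)
  note \<delta> = \<delta>0[THEN conjunct1] and \<delta>all = \<delta>0[THEN conjunct2]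
  have acd: "(\<Sum>k<n. \<bar>g (y k) - g (x k)\<bar>) < e / 2"
    if "\<And>k. k < n \<Longrightarrow> a \<le> x k \<and> x k \<le> y k \<and> y k \<le> b"
      "\<And>j k. j < n \<Longrightarrow> k < n \<Longrightarrow> j \<noteq> k \<Longrightarrow> {x j<..<y j} \<inter> {x k<..<y k} = {}"
      "(\<Sum>k<n. y k - x k) < \<delta>" for n :: nat and x y
    by (rule \<delta>all[THEN spec, THEN spec, THEN spec, THEN mp]) (use that in blast)
  obtain W where W: "open W" "N \<subseteq> W" "W \<in> lmeasurable" "measure lebesgue W < \<delta>"
  proof -
    have Nm: "N \<in> sets lebesgue" "N \<in> lmeasurable" using N 
      by (auto simp: negligible_imp_measurable negligible_imp_sets)
    obtain W where W: "open W" "N \<subseteq> W" "W - N \<in> lmeasurable" "emeasure lebesgue (W - N) < ennreal \<delta>"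
      using sets_lebesgue_outer_open[OF Nm(1) \<delta>] by blast
    have "W = (W - N) \<union> N" using W(2) by auto
    moreover have "measure lebesgue (W - N) < \<delta>"
      using W(3,4) \<delta> by (metis emeasure_eq_measure2 ennreal_less_iff measure_nonneg)
    moreover have "measure lebesgue ((W - N) \<union> N) = measure lebesgue (W - N)"
      using N W(3) by (intro measure_Un_null_set) (auto simp: negligible_iff_null_sets[symmetric] fmeasurableD)
    moreover have "(W - N) \<union> N \<in> lmeasurable" using W(3) Nm(2) by (rule fmeasurable.Un)
    ultimately show ?thesis using W by (intro that[of W]) auto
  qed
  have "\<exists>s>0. (x \<in> N \<longrightarrow> ball x s \<subseteq> W) \<and>
        (x \<in> {a..b} - N \<longrightarrow> (\<forall>u v. u \<le> x \<longrightarrow> x \<le> v \<longrightarrow> {u..v} \<subseteq> ball x s \<longrightarrow> - (e1 * (v - u)) \<le> g v - g u))" for x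
  proof (cases "x \<in> N")
    case True
    then show ?thesis using W(1,2) by (meson DiffD2 open_contains_ball subset_iff)
  next
    case False
    show ?thesis
    proof (cases "x \<in> {a..b}")
      case True
      with False deriv obtain D where D: "D \<ge> 0" "(g has_real_derivative D) (at x)" by auto
      then have "((\<lambda>y. (g y - g x) / (y - x)) \<longlongrightarrow> D) (at x)" by (simp add: has_field_derivative_iff)
      then obtain s where s: "s > 0" "\<And>y. y \<noteq> x \<Longrightarrow> dist y x < s \<Longrightarrow> dist ((g y - g x) / (y - x)) D < e1"
        unfolding Lim_at using e1(1) by (metis zero_less_dist_iff)
      have slope: "(g y - g x) / (y - x) \<ge> - e1" if "y \<noteq> x" "y \<in> ball x s" for y
        using s(2)[of y] that D(1) by (auto simp: dist_real_def abs_less_iff)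
      have "- (e1 * (v - u)) \<le> g v - g u" if uv: "u \<le> x" "x \<le> v" "{u..v} \<subseteq> ball x s" for u v
      proof -
        have "- e1 * (v - x) \<le> g v - g x"
        proof (cases "v = x")
          case False
          then have "v > x" using uv by simp
          moreover have "v \<in> ball x s" by (rule subsetD[OF uv(3)]) (use uv in auto)
          ultimately have "(g v - g x) / (v - x) \<ge> - e1" using slope[of v] by simp
          then show ?thesis using \<open>v > x\<close> by (simp add: field_simps)
        qed simp
        moreover have "- e1 * (x - u) \<le> g x - g u"
        proof (cases "u = x")
          case False
          then have "u < x" using uv by simp
          moreover have "(g u - g x) / (u - x) = (g x - g u) / (x - u)"
            by (metis minus_diff_eq minus_divide_divide)
          moreover have "u \<in> ball x s" by (rule subsetD[OF uv(3)]) (use uv in auto)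
          ultimately have "(g x - g u) / (x - u) \<ge> - e1" using slope[of u] by simp
          then show ?thesis using \<open>u < x\<close> by (simp add: field_simps)
        qed simp
        ultimately show ?thesis by (simp add: algebra_simps)
      qed
      then show ?thesis using s(1) False by blast
    qed (use False in \<open>auto intro: exI[of _ 1]\<close>)
  qed
  then obtain s where s: "\<And>x. s x > 0" "\<And>x. x \<in> N \<Longrightarrow> ball x (s x) \<subseteq> W"
     "\<And>x u v. x \<in> {a..b} - N \<Longrightarrow> u \<le> x \<Longrightarrow> x \<le> v \<Longrightarrow> {u..v} \<subseteq> ball x (s x) \<Longrightarrow> - (e1 * (v - u)) \<le> g v - g u"
    by metis
  have "gauge (\<lambda>x. ball x (s x))" using s(1) by (auto simp: gauge_def)
  then obtain p where p: "p tagged_division_of {a..b}" "(\<lambda>x. ball x (s x)) fine p"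
    by (rule fine_division_exists_real)
  note pD = tagged_division_ofD[OF p(1)]
  define len inc where "len = (\<lambda>(x::real,k::real set). Sup k - Inf k)" and "inc = (\<lambda>(x::real,k). g (Sup k) - g (Inf k))"
  have pk: "\<exists>u v. k = {u..v} \<and> u \<le> x \<and> x \<le> v \<and> a \<le> u \<and> v \<le> b \<and> u \<le> v \<and> Inf k = u \<and> Sup k = v \<and> k \<subseteq> ball x (s x)"
    if xk: "(x,k) \<in> p" for x k
  proof -
    obtain u v where k: "k = {u..v}" using pD(4)[OF xk] by (auto simp: box_real)
    have x: "x \<in> k" "k \<subseteq> {a..b}" "k \<subseteq> ball x (s x)" using pD(2,3)[OF xk] fineD[OF p(2) xk] by auto
    then have "u \<le> v" "a \<le> u" "v \<le> b" using k by auto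
    then show ?thesis using k x by (intro exI[of _ u] exI[of _ v]) auto
  qed
  have fin: "finite p" using pD(1) .
  have tot: "(\<Sum>i\<in>p. inc i) = g b - g a"
    using additive_tagged_division_1[OF ab p(1), of g] by (simp add: inc_def split_def)
  have totlen: "(\<Sum>i\<in>p. len i) = b - a"
    using additive_tagged_division_1[OF ab p(1), of "\<lambda>x. x"] by (simp add: len_def split_def)
  have len0: "len i \<ge> 0" if "i \<in> p" for i using pk that by (cases i) (auto simp: len_def dest!: pk)
  \<comment> \<open>The division splits according to whether the tag lies in the exceptional set.\<close>
  define p1 p2 where "p1 = {i \<in> p. fst i \<notin> N}" and "p2 = {i \<in> p. fst i \<in> N}"
  have split: "sum h p = sum h p1 + sum h p2" for h :: "_ \<Rightarrow> real"
  proof -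
    have "p = p1 \<union> p2" "p1 \<inter> p2 = {}" by (auto simp: p1_def p2_def)
    moreover have "finite p1" "finite p2" using fin by (auto simp: p1_def p2_def)
    ultimately show ?thesis by (metis sum.union_disjoint)
  qed
  have "- (e1 * (b - a)) \<le> - (e1 * sum len p1)"
  proof -
    have "sum len p2 \<ge> 0" using len0 by (intro sum_nonneg) (auto simp: p2_def)
    then show ?thesis using totlen split[of len] e1(1) by simp
  qed
  also have "\<dots> = (\<Sum>i\<in>p1. - (e1 * len i))" by (simp add: sum_distrib_left sum_negf)
  also have "\<dots> \<le> sum inc p1"
  proof (rule sum_mono)
    fix i assume i: "i \<in> p1"
    obtain x k where ieq: "i = (x,k)" by (cases i)
    with i have xk: "(x,k) \<in> p" "x \<notin> N" by (auto simp: p1_def)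
    from pk[OF xk(1)] obtain u v where uv: "k = {u..v}" "u \<le> x" "x \<le> v" "a \<le> u" "v \<le> b" "u \<le> v" "Inf k = u" "Sup k = v" "k \<subseteq> ball x (s x)"
      by blast
    have "x \<in> {a..b} - N" using xk(2) uv by auto
    from s(3)[OF this uv(2,3)] uv show "- (e1 * len i) \<le> inc i"
      by (auto simp: ieq len_def inc_def)
  qed
  finally have part1: "- (e / 2) \<le> sum inc p1" using e1 by linarith
  have part2: "\<bar>sum inc p2\<bar> < e / 2"
  proof -
    have fin2: "finite p2" using fin by (simp add: p2_def)
    then obtain h where h: "bij_betw h {..<card p2} p2"
      using ex_bij_betw_nat_finite atLeast0LessThan by metis
    define X Y where "X n = Inf (snd (h n))" and "Y n = Sup (snd (h n))" for n
    have hp: "\<exists>x k. h n = (x,k) \<and> (x,k) \<in> p \<and> x \<in> N \<and> k = {X n..Y n} \<and> X n \<le> Y n \<and> a \<le> X n \<and> Y n \<le> b \<and> {X n..Y n} \<subseteq> W"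
      if n: "n < card p2" for n
    proof -
      have "h n \<in> p2" using h n by (auto simp: bij_betw_def)
      then obtain x k where xk: "h n = (x,k)" "(x,k) \<in> p" "x \<in> N" by (cases "h n") (auto simp: p2_def)
      from pk[OF xk(2)] s(2)[OF xk(3)] xk show ?thesis by (fastforce simp: X_def Y_def)
    qed
    have disj: "{X j<..<Y j} \<inter> {X k<..<Y k} = {}" if jk: "j < card p2" "k < card p2" "j \<noteq> k" for j k
    proof -
      have "h j \<noteq> h k" using h jk by (auto simp: bij_betw_def inj_on_def)
      then show ?thesis
        using hp[OF jk(1)] hp[OF jk(2)] pD(5) by (metis interior_atLeastAtMost_real)
    qed
    have "(\<Sum>k<card p2. Y k - X k) = (\<Sum>k<card p2. measure lebesgue {X k<..<Y k})"
    proof (intro sum.cong refl)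
      fix k assume "k \<in> {..<card p2}"
      then have "X k \<le> Y k" using hp by blast
      then show "Y k - X k = measure lebesgue {X k<..<Y k}" by simp
    qed
    also have "\<dots> = measure lebesgue (\<Union>k<card p2. {X k<..<Y k})"
      using disj by (intro measure_UNION'[symmetric]) (auto simp: pairwise_def disjnt_def)
    also have "\<dots> \<le> measure lebesgue W"
    proof (rule measure_mono_fmeasurable)
      show "(\<Union>k<card p2. {X k<..<Y k}) \<subseteq> W"
        using hp by (fastforce dest: less_imp_le)
    qed (use W in auto)
    finally have "(\<Sum>k<card p2. Y k - X k) < \<delta>" using W by simp
    then have lt: "(\<Sum>k<card p2. \<bar>g (Y k) - g (X k)\<bar>) < e / 2"
      using disj hp by (intro acd) blast+
    have "\<bar>sum inc p2\<bar> \<le> (\<Sum>i\<in>p2. \<bar>inc i\<bar>)" by (rule sum_abs)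
    also have "\<dots> = (\<Sum>k<card p2. \<bar>inc (h k)\<bar>)" by (rule sum.reindex_bij_betw[OF h, symmetric])
    also have "\<dots> = (\<Sum>k<card p2. \<bar>g (Y k) - g (X k)\<bar>)"
      by (simp add: inc_def X_def Y_def split_def)
    finally show ?thesis using lt by simp
  qed
  have "g b - g a = sum inc p1 + sum inc p2" using tot split[of inc] by simp
  then show "g a \<le> g b + e" using part1 part2 by linarith
qed

text \<open>With \<open>h\<close> constant this says that Lipschitz functions are absolutely continuous.\<close>
lemma absolutely_continuous_dominated:
  assumes ac: "absolutely_continuous_fun_on a' b' h" and K: "K \<ge> 0" and sub: "a' \<le> a" "b \<le> b'"
    and dom: "\<And>x y. a \<le> x \<Longrightarrow> x \<le> y \<Longrightarrow> y \<le> b \<Longrightarrow> \<bar>g y - g x\<bar> \<le> K * (\<bar>h y - h x\<bar> + (y - x))"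
  shows "absolutely_continuous_fun_on a b g"
  unfolding absolutely_continuous_fun_on_def
proof (intro allI impI)
  fix e :: real assume e: "e > 0"
  define e1 where "e1 = e / (2 * (K + 1))"
  have e1: "e1 > 0" using e K by (simp add: e1_def)
  obtain \<delta> where \<delta>0: "\<delta> > 0 \<and> (\<forall>(n::nat) x y.
        (\<forall>k<n. a' \<le> x k \<and> x k \<le> y k \<and> y k \<le> b') \<and>
        (\<forall>j<n. \<forall>k<n. j \<noteq> k \<longrightarrow> {x j<..<y j} \<inter> {x k<..<y k} = {}) \<and>
        (\<Sum>k<n. y k - x k) < \<delta> \<longrightarrow> (\<Sum>k<n. \<bar>h (y k) - h (x k)\<bar>) < e1)"
    using ac[unfolded absolutely_continuous_fun_on_def, THEN spec, THEN mp, OF e1] by (rule exE)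
  note \<delta> = \<delta>0[THEN conjunct1] and \<delta>all = \<delta>0[THEN conjunct2]
  show "\<exists>\<delta>>0. \<forall>(n::nat) x y.
        (\<forall>k<n. a \<le> x k \<and> x k \<le> y k \<and> y k \<le> b) \<and>
        (\<forall>j<n. \<forall>k<n. j \<noteq> k \<longrightarrow> {x j<..<y j} \<inter> {x k<..<y k} = {}) \<and>
        (\<Sum>k<n. y k - x k) < \<delta> \<longrightarrow> (\<Sum>k<n. \<bar>g (y k) - g (x k)\<bar>) < e"
  proof (rule exI[of _ "min \<delta> e1"], intro conjI allI impI)
    show "min \<delta> e1 > 0" using \<delta> e1 by simp
    fix n :: nat and x y :: "nat \<Rightarrow> real"
    assume H: "(\<forall>k<n. a \<le> x k \<and> x k \<le> y k \<and> y k \<le> b) \<and>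
        (\<forall>j<n. \<forall>k<n. j \<noteq> k \<longrightarrow> {x j<..<y j} \<inter> {x k<..<y k} = {}) \<and>
        (\<Sum>k<n. y k - x k) < min \<delta> e1"
    have "(\<Sum>k<n. \<bar>h (y k) - h (x k)\<bar>) < e1"
    proof (rule \<delta>all[THEN spec, THEN spec, THEN spec, THEN mp], intro conjI)
      show "\<forall>k<n. a' \<le> x k \<and> x k \<le> y k \<and> y k \<le> b'" using H sub by force
    qed (use H in auto)
    moreover have "(\<Sum>k<n. y k - x k) < e1" using H by simp
    ultimately have lt: "(\<Sum>k<n. \<bar>h (y k) - h (x k)\<bar>) + (\<Sum>k<n. y k - x k) \<le> 2 * e1" by simp
    have "(\<Sum>k<n. \<bar>g (y k) - g (x k)\<bar>) \<le> (\<Sum>k<n. K * (\<bar>h (y k) - h (x k)\<bar> + (y k - x k)))"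
      using H by (intro sum_mono dom) auto
    also have "\<dots> = K * ((\<Sum>k<n. \<bar>h (y k) - h (x k)\<bar>) + (\<Sum>k<n. y k - x k))"
      unfolding sum_distrib_left[symmetric] sum.distrib ..
    also have "\<dots> \<le> K * (2 * e1)" using lt K by (rule mult_left_mono)
    also have "\<dots> < e" using K e by (simp add: e1_def field_simps)
    finally show "(\<Sum>k<n. \<bar>g (y k) - g (x k)\<bar>) < e" .
  qed
qed

lemma nondecreasing_glue:
  fixes g :: "real \<Rightarrow> real"
  assumes p: "p > 0"
    and loc: "\<And>k::int. \<And>x y. p * of_int k \<le> x \<Longrightarrow> x \<le> y \<Longrightarrow> y \<le> p * (of_int k + 1) \<Longrightarrow> g x \<le> g y"
    and xy: "x \<le> y"
  shows "g x \<le> g y"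
  using xy
proof (induction "nat (\<lfloor>y / p\<rfloor> - \<lfloor>x / p\<rfloor>)" arbitrary: x)
  case 0
  have "\<lfloor>x / p\<rfloor> \<le> \<lfloor>y / p\<rfloor>" using 0 p by (intro floor_mono divide_right_mono) auto
  then have eq: "\<lfloor>y / p\<rfloor> = \<lfloor>x / p\<rfloor>" using 0 by simp
  have "of_int \<lfloor>x / p\<rfloor> \<le> x / p" "y / p \<le> of_int \<lfloor>y / p\<rfloor> + 1" by linarith+
  then have "p * of_int \<lfloor>x / p\<rfloor> \<le> p * (x / p)" "p * (y / p) \<le> p * (of_int \<lfloor>x / p\<rfloor> + 1)"
    using p eq by (auto intro!: mult_left_mono simp del: times_divide_eq_right)
  then show ?case using 0 p by (intro loc[of "\<lfloor>x / p\<rfloor>"]) auto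
next
  case (Suc n)
  define z where "z = p * (of_int \<lfloor>x / p\<rfloor> + 1)"
  have fz: "\<lfloor>z / p\<rfloor> = \<lfloor>x / p\<rfloor> + 1" using p by (simp add: z_def)
  have lt: "\<lfloor>x / p\<rfloor> + 1 \<le> \<lfloor>y / p\<rfloor>" using Suc(2) by linarith
  then have "of_int \<lfloor>x / p\<rfloor> + 1 \<le> y / p" by linarith
  then have zy: "z \<le> y" using p by (simp add: z_def field_simps)
  have "of_int \<lfloor>x / p\<rfloor> \<le> x / p" "x / p \<le> of_int \<lfloor>x / p\<rfloor> + 1" by linarith+
  then have "p * of_int \<lfloor>x / p\<rfloor> \<le> p * (x / p)" "p * (x / p) \<le> z"
    unfolding z_def using p by (auto intro!: mult_left_mono simp del: times_divide_eq_right)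
  then have "p * of_int \<lfloor>x / p\<rfloor> \<le> x" "x \<le> z" using p by auto
  then have "g x \<le> g z" by (intro loc[of "\<lfloor>x / p\<rfloor>"]) (auto simp: z_def)
  also have "g z \<le> g y" using Suc(2) fz lt zy by (intro Suc(1)) auto
  finally show ?case .
qed

section \<open>Spiral coordinates and the cone of the standard domain\<close>

text \<open>The open convex cone spanned by \<open>- cis \<mu>\<^sub>1\<close> and \<open>- cis \<mu>\<^sub>2\<close>, where \<open>\<mu>\<^sub>1\<close> and \<open>\<mu>\<^sub>2\<close> are \<open>lam\<close> shifted
  by \<open>\<beta> - pi/2\<close> and by \<open>pi/2 - \<beta>\<close>.\<close>
definition log_cone :: "real \<Rightarrow> real \<Rightarrow> complex set" where
  "log_cone lam \<beta> = {c. \<exists>a>0. \<exists>b>0. c = - (of_real a * cis (lam - (pi/2 - \<beta>)) + of_real b * cis (lam + (pi/2 - \<beta>)))}"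

text \<open>The constants \<open>A > 0\<close> and \<open>B < 0\<close> of the standard domain, in terms of \<open>\<beta> = pi * al / 2\<close>.\<close>
definition slopeA :: "real \<Rightarrow> real \<Rightarrow> real" where
  "slopeA lam \<beta> = (cos lam)\<^sup>2 * (tan \<beta> - tan lam)"

definition slopeB :: "real \<Rightarrow> real \<Rightarrow> real" where
  "slopeB lam \<beta> = - ((cos lam)\<^sup>2 * (tan \<beta> + tan lam))"

text \<open>The point with spiral coordinates \<open>(exp s, \<theta>)\<close>. The radius enters through its logarithm \<open>s\<close>, so that
  the spiral coordinates become additive.\<close>
definition spiral_exp :: "real \<Rightarrow> real \<Rightarrow> real \<Rightarrow> complex" where
  "spiral_exp lam s \<theta> = exp (Complex s (\<theta> + tan lam * s))"

lemma spiral_point_exp: "spiral_point lam (exp s) \<theta> = spiral_exp lam s \<theta>"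
  by (simp add: spiral_point_def spiral_exp_def exp_eq_polar cis_conv_exp[symmetric] exp_of_real)

lemma spiral_exp_add: "spiral_exp lam s \<theta> * exp (Complex s' (\<theta>' + tan lam * s')) = spiral_exp lam (s + s') (\<theta> + \<theta>')"
  unfolding spiral_exp_def exp_add[symmetric] by (simp add: algebra_simps complex_add)

lemma spiral_exp_2pi: "spiral_exp lam s (\<theta> + 2 * pi) = spiral_exp lam s \<theta>"
proof -
  have "Complex s (\<theta> + 2 * pi + tan lam * s) = Complex s (\<theta> + tan lam * s) + of_real (2 * pi) * \<i>"
    by (simp add: complex_eq_iff)
  then show ?thesis by (simp add: spiral_exp_def exp_add exp_two_pi_i)
qed

lemma spiral_exp_2pi_int: "spiral_exp lam s (\<theta> + 2 * pi * of_int k) = spiral_exp lam s \<theta>"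
proof -
  have "Complex s (\<theta> + 2 * pi * of_int k + tan lam * s) = Complex s (\<theta> + tan lam * s) + of_real (real_of_int (2 * k) * pi) * \<i>"
    by (simp add: complex_eq_iff)
  then show ?thesis unfolding spiral_exp_def exp_eq by metis
qed

lemma spiral_exp_eqD:
  assumes "spiral_exp lam s \<theta> = spiral_exp lam s' \<theta>'"
  shows "s = s'" "\<exists>k::int. \<theta> = \<theta>' + 2 * pi * of_int k"
proof -
  from assms obtain k :: int where k: "Complex s (\<theta> + tan lam * s) = Complex s' (\<theta>' + tan lam * s') + (2 * of_int k * pi) * \<i>"
    unfolding spiral_exp_def exp_eq by auto
  then show 1: "s = s'" by (simp add: complex_eq_iff)
  from k 1 have "\<theta> = \<theta>' + 2 * pi * of_int k" by (simp add: complex_eq_iff)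
  then show "\<exists>k::int. \<theta> = \<theta>' + 2 * pi * of_int k" ..
qed

lemma spiral_exp_surj:
  assumes "w \<noteq> 0"
  obtains \<theta> where "w = spiral_exp lam (ln (cmod w)) \<theta>" 
proof -
  have "w = exp (Ln w)" using assms by simp
  also have "Ln w = Complex (ln (cmod w)) ((Im (Ln w) - tan lam * ln (cmod w)) + tan lam * ln (cmod w))"
    using assms by (simp add: complex_eq_iff)
  finally show ?thesis using that by (metis spiral_exp_def)
qed

lemma norm_spiral_exp: "cmod (spiral_exp lam s \<theta>) = exp s"
  by (simp add: spiral_exp_def norm_exp_eq_Re)

text \<open>The standing assumption on the parameters, with \<open>\<beta>\<close> in place of \<open>pi * al / 2\<close>.\<close>
locale spiral_params =
  fixes lam \<beta> :: real
  assumes lam: "\<bar>lam\<bar> < \<beta>" and beta: "\<beta> < pi / 2"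
begin

abbreviation "A \<equiv> slopeA lam \<beta>"
abbreviation "B \<equiv> slopeB lam \<beta>"
abbreviation "mu1 \<equiv> lam - (pi/2 - \<beta>)"
abbreviation "mu2 \<equiv> lam + (pi/2 - \<beta>)"

lemma cos_pos: "cos lam > 0" "cos \<beta> > 0" "sin \<beta> > 0"
  using lam beta by (auto intro!: cos_gt_zero_pi sin_gt_zero)

lemma A_eq: "A = cos lam * sin (\<beta> - lam) / cos \<beta>"
  using cos_pos by (simp add: slopeA_def tan_def sin_diff field_simps power2_eq_square)

lemma B_eq: "B = - (cos lam * sin (\<beta> + lam) / cos \<beta>)"
  using cos_pos by (simp add: slopeB_def tan_def sin_add field_simps power2_eq_square)

lemma A_pos: "A > 0" and B_neg: "B < 0"
proof -
  have "sin (\<beta> - lam) > 0" "sin (\<beta> + lam) > 0" using lam beta by (auto intro!: sin_gt_zero)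
  then show "A > 0" "B < 0" using cos_pos unfolding A_eq B_eq by auto
qed

text \<open>The two boundary spirals of the standard domain, \<open>log r = B * \<theta>\<close> and \<open>log r = A * \<theta>\<close>, have the directions
  \<open>- cis mu1\<close> and \<open>cis mu2\<close> in the logarithmic plane, for increasing \<open>\<theta>\<close>.\<close>
lemma cis_edge_B: "cis mu1 = - of_real (cos \<beta> / cos lam) * Complex B (1 + tan lam * B)"
proof -
  have a: "lam - (pi/2 - \<beta>) = (lam + \<beta>) - pi/2" by simp
  have "1 + tan lam * B = cos lam * cos (lam + \<beta>) / cos \<beta>"
  proof -
    have "cos \<beta> * (1 + tan lam * B) = cos \<beta> - sin lam * sin (\<beta> + lam)"
      using cos_pos unfolding B_eq by (simp add: tan_def field_simps)
    also have "\<dots> = cos \<beta> * (1 - (sin lam)\<^sup>2) - sin lam * cos lam * sin \<beta>"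
      by (simp add: sin_add algebra_simps power2_eq_square)
    also have "\<dots> = cos lam * cos (lam + \<beta>)"
      unfolding cos_squared_eq[symmetric] by (simp add: cos_add algebra_simps power2_eq_square)
    finally show ?thesis using cos_pos by (simp add: field_simps)
  qed
  then show ?thesis
    unfolding a using cos_pos
    by (simp add: complex_eq_iff B_eq cos_diff sin_diff add.commute)
qed

lemma cis_edge_A: "cis mu2 = of_real (cos \<beta> / cos lam) * Complex A (1 + tan lam * A)"
proof -
  have a: "lam + (pi/2 - \<beta>) = pi/2 - (\<beta> - lam)" by simp
  have "1 + tan lam * A = cos lam * cos (\<beta> - lam) / cos \<beta>"
  proof -
    have "cos \<beta> * (1 + tan lam * A) = cos \<beta> + sin lam * sin (\<beta> - lam)"
      using cos_pos unfolding A_eq by (simp add: tan_def field_simps)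
    also have "\<dots> = cos \<beta> * (1 - (sin lam)\<^sup>2) + sin lam * cos lam * sin \<beta>"
      by (simp add: sin_diff algebra_simps power2_eq_square)
    also have "\<dots> = cos lam * cos (\<beta> - lam)"
      unfolding cos_squared_eq[symmetric] by (simp add: cos_diff algebra_simps power2_eq_square)
    finally show ?thesis using cos_pos by (simp add: field_simps)
  qed
  then show ?thesis
    unfolding a using cos_pos
    by (simp add: complex_eq_iff A_eq cos_diff sin_diff)
qed

text \<open>The cone in spiral coordinates.\<close>
lemma log_cone_iff: "Complex s (\<theta> + tan lam * s) \<in> log_cone lam \<beta> \<longleftrightarrow> s < A * \<theta> \<and> s < B * \<theta>"
proof -
  define \<kappa> where "\<kappa> = cos \<beta> / cos lam"
  have \<kappa>: "\<kappa> > 0" using cos_pos by (simp add: \<kappa>_def)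
  have eq: "Complex s (\<theta> + tan lam * s) = - (of_real a * cis mu1 + of_real b * cis mu2)
     \<longleftrightarrow> s = \<kappa> * (a * B - b * A) \<and> \<theta> = \<kappa> * (a - b)" for a b
  proof -
    have "- (of_real a * cis mu1 + of_real b * cis mu2)
        = Complex (\<kappa> * (a * B - b * A)) (\<kappa> * (a - b) + tan lam * (\<kappa> * (a * B - b * A)))"
      unfolding cis_edge_B cis_edge_A \<kappa>_def[symmetric] by (simp add: complex_eq_iff algebra_simps)
    then show ?thesis by auto
  qed
  show ?thesis
  proof
    assume "Complex s (\<theta> + tan lam * s) \<in> log_cone lam \<beta>"
    then obtain a b where ab: "a > 0" "b > 0" "s = \<kappa> * (a * B - b * A)" "\<theta> = \<kappa> * (a - b)"
      unfolding log_cone_def mem_Collect_eq eq by blast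
    have "A * \<theta> - s = \<kappa> * (a * (A - B))" "B * \<theta> - s = \<kappa> * (b * (A - B))"
      unfolding ab(3,4) by (simp_all add: algebra_simps)
    moreover have "\<kappa> * (a * (A - B)) > 0" "\<kappa> * (b * (A - B)) > 0"
      using \<kappa> ab(1,2) A_pos B_neg by (auto intro!: mult_pos_pos)
    ultimately show "s < A * \<theta> \<and> s < B * \<theta>" by linarith
  next
    assume r: "s < A * \<theta> \<and> s < B * \<theta>"
    define a b where "a = (A * \<theta> - s) / (\<kappa> * (A - B))" and "b = (B * \<theta> - s) / (\<kappa> * (A - B))"
    have d: "\<kappa> * (A - B) > 0" using \<kappa> A_pos B_neg by (auto intro!: mult_pos_pos)
    have "a > 0" "b > 0" using r d by (auto simp: a_def b_def)
    moreover have "s = \<kappa> * (a * B - b * A)" "\<theta> = \<kappa> * (a - b)"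
      using d \<kappa> A_pos B_neg by (auto simp: a_def b_def divide_simps) (auto simp: algebra_simps)
    ultimately show "Complex s (\<theta> + tan lam * s) \<in> log_cone lam \<beta>"
      unfolding log_cone_def mem_Collect_eq eq by blast
  qed
qed

lemma log_cone_Re_Im_iff: "c \<in> log_cone lam \<beta> \<longleftrightarrow>
    Re c < A * (Im c - tan lam * Re c) \<and> Re c < B * (Im c - tan lam * Re c)"
  using log_cone_iff[of "Re c" "Im c - tan lam * Re c"] by simp

lemma open_log_cone: "open (log_cone lam \<beta>)"
proof -
  have "log_cone lam \<beta> = {c. Re c < A * (Im c - tan lam * Re c)} \<inter> {c. Re c < B * (Im c - tan lam * Re c)}"
    using log_cone_Re_Im_iff by auto
  then show ?thesis by (auto intro!: open_Int open_Collect_less continuous_intros)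
qed

lemma standard_domain_eq:
  assumes "al = 2 * \<beta> / pi"
  shows "standard_domain lam al = insert 0 (exp ` log_cone lam \<beta>)"
proof -
  have be: "pi * al / 2 = \<beta>" using assms by simp
  have sd: "standard_domain lam al = {spiral_point lam r \<theta> | r \<theta>.
            0 \<le> \<theta> \<and> \<theta> < 2 * pi \<and> 0 \<le> r \<and> r < max (exp (B * \<theta>)) (exp (- A * (2 * pi - \<theta>)))}"
    unfolding standard_domain_def Let_def be slopeA_def slopeB_def by simp
  show ?thesis
  proof (intro set_eqI iffI)
    fix u assume "u \<in> standard_domain lam al"
    then obtain r \<theta> where u: "u = spiral_point lam r \<theta>" "0 \<le> \<theta>" "\<theta> < 2 * pi" "0 \<le> r"
      "r < max (exp (B * \<theta>)) (exp (- A * (2 * pi - \<theta>)))" unfolding sd by blast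
    show "u \<in> insert 0 (exp ` log_cone lam \<beta>)"
    proof (cases "r = 0")
      case True then show ?thesis using u by (simp add: spiral_point_def)
    next
      case False
      define s where "s = ln r"
      have r: "r = exp s" using False u by (simp add: s_def)
      have uu: "u = spiral_exp lam s \<theta>" using u(1) r spiral_point_exp by simp
      from u(5) r consider "s < B * \<theta>" | "s < - A * (2 * pi - \<theta>)" by (auto simp: less_max_iff_disj)
      then obtain \<theta>' where \<theta>': "u = spiral_exp lam s \<theta>'" "s < A * \<theta>'" "s < B * \<theta>'"
      proof cases
        case 1
        have "B * \<theta> \<le> 0" "0 \<le> A * \<theta>" using A_pos B_neg u(2) by (auto simp: mult_nonpos_nonneg)
        with 1 uu that[of \<theta>] show ?thesis by linarith
      next
        case 2
        have "u = spiral_exp lam s (\<theta> - 2 * pi)" using uu spiral_exp_2pi[of lam s "\<theta> - 2 * pi"] by simp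
        moreover have "- A * (2 * pi - \<theta>) = A * (\<theta> - 2 * pi)" by (simp add: algebra_simps)
        moreover have "A * (\<theta> - 2 * pi) \<le> 0" "0 \<le> B * (\<theta> - 2 * pi)" 
          using A_pos B_neg u(3) by (auto simp: mult_nonneg_nonpos mult_nonpos_nonpos)
        ultimately show ?thesis using 2 by (intro that[of "\<theta> - 2 * pi"]) auto
      qed
      then show ?thesis using log_cone_iff by (auto simp: spiral_exp_def)
    qed
  next
    fix u assume "u \<in> insert 0 (exp ` log_cone lam \<beta>)"
    then consider "u = 0" | c where "u = exp c" "c \<in> log_cone lam \<beta>" by auto
    then show "u \<in> standard_domain lam al"
    proof cases
      case 1
      then show ?thesis unfolding sd by (auto intro!: exI[of _ 0] simp: spiral_point_def)
    next
      case 2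
      define s \<theta> where "s = Re c" and "\<theta> = Im c - tan lam * s"
      have "c = Complex s (\<theta> + tan lam * s)" by (simp add: s_def \<theta>_def)
      then have u: "u = spiral_exp lam s \<theta>" and s: "s < A * \<theta>" "s < B * \<theta>"
        using 2 log_cone_iff by (auto simp: spiral_exp_def)
      define k where "k = \<lfloor>\<theta> / (2 * pi)\<rfloor>"
      define \<theta>0 where "\<theta>0 = \<theta> - 2 * pi * of_int k"
      have k: "of_int k \<le> \<theta> / (2 * pi)" "\<theta> / (2 * pi) < of_int k + 1" by (auto simp: k_def)
      have \<theta>0: "0 \<le> \<theta>0" "\<theta>0 < 2 * pi" using k by (auto simp: \<theta>0_def field_simps)
      have u0: "u = spiral_point lam (exp s) \<theta>0"
        using u spiral_exp_2pi_int[of lam s \<theta>0 k] by (simp add: spiral_point_exp \<theta>0_def)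
      have "s < B * \<theta>0 \<or> s < - A * (2 * pi - \<theta>0)"
      proof (cases "k \<ge> 0")
        case True
        then have "\<theta>0 \<le> \<theta>" by (simp add: \<theta>0_def)
        then have "B * \<theta> \<le> B * \<theta>0" using B_neg by (intro mult_left_mono_neg) auto
        then show ?thesis using s by simp
      next
        case False
        then have "2 * pi * of_int k \<le> 2 * pi * (- 1)" by (intro mult_left_mono) auto
        then have "\<theta> \<le> \<theta>0 - 2 * pi" by (simp add: \<theta>0_def)
        then have "A * \<theta> \<le> A * (\<theta>0 - 2 * pi)" using A_pos by (intro mult_left_mono) auto
        then show ?thesis using s by (simp add: algebra_simps)
      qed
      then have "exp s < max (exp (B * \<theta>0)) (exp (- A * (2 * pi - \<theta>0)))" by (auto simp: less_max_iff_disj)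
      then show ?thesis unfolding sd using u0 \<theta>0
        by (intro CollectI exI[of _ "exp s"] exI[of _ \<theta>0] conjI) auto
    qed
  qed
qed

text \<open>The standard domain contains a disc around the origin.\<close>
lemma small_in_exp_cone:
  assumes "w \<noteq> 0" "cmod w < exp (2 * pi * B)"
  shows "w \<in> exp ` log_cone lam \<beta>"
proof -
  obtain \<theta> where w: "w = spiral_exp lam (ln (cmod w)) \<theta>" using spiral_exp_surj assms(1) by blast
  define s where "s = ln (cmod w)"
  have s: "s < 2 * pi * B" using assms unfolding s_def by (metis exp_less_cancel_iff exp_ln zero_less_norm_iff)
  define k where "k = \<lfloor>\<theta> / (2 * pi)\<rfloor>"
  define \<theta>0 where "\<theta>0 = \<theta> - 2 * pi * of_int k"
  have k: "of_int k \<le> \<theta> / (2 * pi)" "\<theta> / (2 * pi) < of_int k + 1" by (auto simp: k_def)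
  have \<theta>0: "0 \<le> \<theta>0" "\<theta>0 < 2 * pi" using k by (auto simp: \<theta>0_def field_simps)
  have "w = spiral_exp lam s \<theta>0"
    using w spiral_exp_2pi_int[of lam s \<theta>0 k] by (simp add: s_def \<theta>0_def)
  moreover have "B * (2 * pi) \<le> B * \<theta>0" using B_neg \<theta>0 by (intro mult_left_mono_neg) auto
  then have "s < B * \<theta>0" using s by (simp add: mult.commute)
  moreover have "s < A * \<theta>0" 
  proof -
    have "2 * pi * B < 0" "0 \<le> A * \<theta>0" using B_neg A_pos \<theta>0 by (auto simp: mult_pos_neg)
    then show ?thesis using s by linarith
  qed
  ultimately show ?thesis using log_cone_iff by (auto simp: spiral_exp_def)
qed

text \<open>Invariance of a set under multiplication by the elements of the standard domain other than \<open>0\<close>.\<close>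
definition cone_invariant :: "complex set \<Rightarrow> bool" where
  "cone_invariant \<Omega> \<longleftrightarrow> (\<forall>w\<in>\<Omega>. \<forall>c\<in>log_cone lam \<beta>. w * exp c \<in> \<Omega>)"

lemma spiral_dir_in_cone: "t > 0 \<Longrightarrow> Complex (- t) (tan lam * (- t)) \<in> log_cone lam \<beta>"
  using log_cone_iff[of "-t" 0] by simp

text \<open>For an open set the invariance extends to the closed cone: the point is first moved slightly
  against the cone, inside the set.\<close>
lemma cone_invariant_edges:
  assumes inv: "cone_invariant \<Omega>" and "open \<Omega>" and w: "w \<in> \<Omega>" and ab: "a \<ge> 0" "b \<ge> 0"
  shows "w * exp (- (of_real a * cis mu1 + of_real b * cis mu2)) \<in> \<Omega>"
proof -
  define d where "d = cis mu1 + cis mu2"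
  have "((\<lambda>\<eta>::real. w * exp (of_real \<eta> * d)) \<longlongrightarrow> w * exp (of_real 0 * d)) (at_right 0)"
    by (intro tendsto_intros)
  then have "((\<lambda>\<eta>::real. w * exp (of_real \<eta> * d)) \<longlongrightarrow> w) (at_right 0)" by simp
  then have "eventually (\<lambda>\<eta>. w * exp (of_real \<eta> * d) \<in> \<Omega>) (at_right 0)"
    using assms(2) w topological_tendstoD by blast
  moreover have "eventually (\<lambda>\<eta>::real. \<eta> > 0) (at_right 0)" by (simp add: eventually_at_right_less)
  ultimately obtain \<eta> where \<eta>: "\<eta> > 0" "w * exp (of_real \<eta> * d) \<in> \<Omega>"
    by (metis (mono_tags, lifting) eventually_happens' eventually_conj trivial_limit_at_right_real)
  have "- (of_real (a + \<eta>) * cis mu1 + of_real (b + \<eta>) * cis mu2) \<in> log_cone lam \<beta>"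
    unfolding log_cone_def using ab \<eta> by (intro CollectI exI[of _ "a + \<eta>"] exI[of _ "b + \<eta>"] conjI) auto
  then have "(w * exp (of_real \<eta> * d)) * exp (- (of_real (a + \<eta>) * cis mu1 + of_real (b + \<eta>) * cis mu2)) \<in> \<Omega>"
    using inv \<eta> unfolding cone_invariant_def by blast
  moreover have "of_real \<eta> * d + - (of_real (a + \<eta>) * cis mu1 + of_real (b + \<eta>) * cis mu2)
     = - (of_real a * cis mu1 + of_real b * cis mu2)"
    by (simp add: d_def algebra_simps)
  ultimately show ?thesis by (metis exp_add mult.assoc)
qed

text \<open>If \<open>z\<close> is not in \<open>\<Omega>\<close>, then points \<open>w\<close> of \<open>\<Omega>\<close> cannot be so large that \<open>z / w\<close> lies in a disc
  around \<open>0\<close> contained in the standard domain.\<close>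
lemma cone_invariant_bounded:
  assumes inv: "cone_invariant \<Omega>" and "\<Omega> \<noteq> UNIV" and "0 \<in> \<Omega>"
  shows "bounded \<Omega>"
proof -
  obtain z where z: "z \<notin> \<Omega>" using assms(2) by auto
  then have z0: "z \<noteq> 0" using assms(3) by auto
  have "cmod w \<le> cmod z / exp (2 * pi * B)" if w: "w \<in> \<Omega>" for w
  proof (rule ccontr)
    assume "\<not> ?thesis"
    then have lt: "cmod z < cmod w * exp (2 * pi * B)" by (simp add: field_simps not_le)
    then have w0: "w \<noteq> 0" using z0 by auto
    have zw: "z / w \<noteq> 0" "cmod (z / w) < exp (2 * pi * B)"
      using z0 w0 lt by (auto simp: norm_divide field_simps)
    obtain c where "c \<in> log_cone lam \<beta>" "z / w = exp c" using small_in_exp_cone[OF zw] by auto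
    then have "w * (z / w) \<in> \<Omega>" using inv w unfolding cone_invariant_def by auto
    then show False using z w0 by simp
  qed
  then show ?thesis unfolding bounded_iff by blast
qed

text \<open>If \<open>x n\<close> in \<open>\<Omega>\<close> tends to \<open>w\<close>, then \<open>w * exp c = x n * exp c'\<close> where \<open>c'\<close> tends to \<open>c\<close> and therefore
  belongs to the open cone eventually.\<close>
lemma cone_invariant_frontier:
  assumes inv: "cone_invariant \<Omega>" and "open \<Omega>" "0 \<in> \<Omega>" and w: "w \<in> frontier \<Omega>" and c: "c \<in> log_cone lam \<beta>"
  shows "w * exp c \<in> \<Omega>"
proof -
  have "w \<notin> \<Omega>" using w assms(2) by (simp add: frontier_def interior_open)
  then have w0: "w \<noteq> 0" using assms(3) by auto
  have "w \<in> closure \<Omega>" using w by (simp add: frontier_def)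
  then obtain x where x: "\<And>n. x n \<in> \<Omega>" "x \<longlonglongrightarrow> w" by (auto simp: closure_sequential)
  have "(\<lambda>n. c + Ln (w / x n)) \<longlonglongrightarrow> c + Ln (w / w)"
    using w0 x(2) by (intro tendsto_intros) auto
  then have lim: "(\<lambda>n. c + Ln (w / x n)) \<longlonglongrightarrow> c" using w0 by simp
  have "eventually (\<lambda>n. c + Ln (w / x n) \<in> log_cone lam \<beta>) sequentially"
    using lim open_log_cone c topological_tendstoD by blast
  moreover have "eventually (\<lambda>n. x n \<noteq> 0) sequentially"
    using x(2) w0 by (simp add: tendsto_imp_eventually_ne)
  ultimately have "eventually (\<lambda>n. c + Ln (w / x n) \<in> log_cone lam \<beta> \<and> x n \<noteq> 0) sequentially"
    by (rule eventually_conj)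
  then obtain n where n: "c + Ln (w / x n) \<in> log_cone lam \<beta>" "x n \<noteq> 0"
    by (auto simp: eventually_sequentially)
  then have "x n * exp (c + Ln (w / x n)) \<in> \<Omega>" using inv x(1) unfolding cone_invariant_def by blast
  then show ?thesis using n(2) w0 by (simp add: exp_add field_simps)
qed

lemma frontier_condition_imp_cone_invariant:
  assumes "open \<Omega>" "connected \<Omega>" "0 \<in> \<Omega>" and unb: "\<not> bounded (- \<Omega>)"
    and fr: "\<And>w c. w \<in> frontier \<Omega> \<Longrightarrow> c \<in> log_cone lam \<beta> \<Longrightarrow> w * exp c \<in> \<Omega>"
  shows "cone_invariant \<Omega>"
proof -
  have notU: "\<Omega> \<noteq> UNIV" using unb by auto
  then obtain z where z: "z \<notin> \<Omega>" by auto
  then have z0: "z \<noteq> 0" using assms(3) by auto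
  have frb: "cmod w \<le> cmod z / exp (2 * pi * B)" if w: "w \<in> frontier \<Omega>" for w
  proof (rule ccontr)
    assume "\<not> ?thesis"
    then have lt: "cmod z < cmod w * exp (2 * pi * B)" by (simp add: field_simps not_le)
    then have w0: "w \<noteq> 0" using z0 by auto
    have zw: "z / w \<noteq> 0" "cmod (z / w) < exp (2 * pi * B)"
      using z0 w0 lt by (auto simp: norm_divide field_simps)
    obtain c where c: "c \<in> log_cone lam \<beta>" "z / w = exp c" using small_in_exp_cone[OF zw] by auto
    then have "w * (z / w) \<in> \<Omega>" using fr[OF w c(1)] by auto
    then show False using z w0 by simp
  qed
  define M where "M = cmod z / exp (2 * pi * B)"
  have bdd: "\<Omega> \<subseteq> cball 0 M"
  proof (rule ccontr)
    assume "\<not> ?thesis"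
    then obtain w where w: "w \<in> \<Omega>" "w \<in> - cball 0 M" by blast
    have conn: "connected (- cball (0::complex) M)"
      by (rule connected_complement_bounded_convex) auto
    have "frontier \<Omega> \<inter> - cball 0 M = {}" using frb unfolding M_def by auto
    then have "- cball 0 M \<subseteq> \<Omega>"
      using connected_Int_frontier[OF conn, of \<Omega>] w by blast
    then have "- \<Omega> \<subseteq> cball 0 M" by auto
    then show False using unb bounded_cball bounded_subset by blast
  qed
  show ?thesis unfolding cone_invariant_def
  proof (intro ballI)
    fix w c assume w: "w \<in> \<Omega>" and c: "c \<in> log_cone lam \<beta>"
    show "w * exp c \<in> \<Omega>"
    proof (cases "w = 0")
      case True then show ?thesis using assms(3) by simp
    next
      case False
      \<comment> \<open>The outward \<open>lam\<close>-spiral through \<open>w\<close>.\<close>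
      define \<gamma> where "\<gamma> t = w * exp (Complex t (tan lam * t))" for t
      have cont: "continuous_on UNIV \<gamma>" unfolding \<gamma>_def
        by (intro continuous_intros)
      obtain T where T: "T \<ge> 0" "\<gamma> T \<notin> \<Omega>"
      proof -
        \<comment> \<open>At this time the spiral has left the disc of radius \<open>M\<close>.\<close>
        define T where "T = max 0 (ln ((M + 1) / cmod w))"
        have M: "M \<ge> 0" by (simp add: M_def)
        have "(M + 1) / cmod w = exp (ln ((M + 1) / cmod w))" using False M by simp
        also have "\<dots> \<le> exp T" by (simp add: T_def)
        finally have "M + 1 \<le> cmod w * exp T" using False by (simp add: field_simps)
        then have "cmod (\<gamma> T) \<ge> M + 1" by (simp add: \<gamma>_def norm_mult norm_exp_eq_Re)
        then have "\<gamma> T \<notin> \<Omega>" using bdd by force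
        then show ?thesis using that[of T] by (simp add: T_def)
      qed
      have "connected (\<gamma> ` {0..T})"
        by (intro connected_continuous_image continuous_on_subset[OF cont]) auto
      moreover have "\<gamma> 0 = w" by (simp add: \<gamma>_def complex_eq_iff flip: zero_complex.code)
      ultimately have "\<gamma> ` {0..T} \<inter> frontier \<Omega> \<noteq> {}"
        using T w by (intro connected_Int_frontier) (force simp: image_iff)+
      then obtain t where t: "t \<ge> 0" "\<gamma> t \<in> frontier \<Omega>" by auto
      have "c - Complex t (tan lam * t) \<in> log_cone lam \<beta>"
        using c t(1) unfolding log_cone_Re_Im_iff by (auto simp: algebra_simps)
      from fr[OF t(2) this] show ?thesis by (simp add: \<gamma>_def exp_diff)
    qed
  qed
qed

end

section \<open>Spirallike functions on the unit disc\<close>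

lemma Re_cis_mult_cis: "Re (cis (- \<mu>) * (of_real s * cis \<phi>)) = s * cos (\<phi> - \<mu>)"
  by (simp add: cos_diff algebra_simps)

lemma sector_iff_half_planes:
  assumes "0 < \<beta>" "\<beta> < pi / 2"
  shows "p \<in> sector lam \<beta> \<longleftrightarrow>
    Re (cis (- (lam - (pi/2 - \<beta>))) * p) > 0 \<and> Re (cis (- (lam + (pi/2 - \<beta>))) * p) > 0"
proof
  assume "p \<in> sector lam \<beta>"
  then obtain s \<phi> where p: "p = of_real s * cis \<phi>" "s > 0" "\<bar>\<phi> - lam\<bar> < \<beta>"
    unfolding sector_def by blast
  have "cos (\<phi> - (lam - (pi/2 - \<beta>))) > 0" "cos (\<phi> - (lam + (pi/2 - \<beta>))) > 0"
    using p(3) assms by (auto intro!: cos_gt_zero_pi)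
  then show "Re (cis (- (lam - (pi/2 - \<beta>))) * p) > 0 \<and> Re (cis (- (lam + (pi/2 - \<beta>))) * p) > 0"
    unfolding p(1) Re_cis_mult_cis using p(2) by simp
next
  assume H: "Re (cis (- (lam - (pi/2 - \<beta>))) * p) > 0 \<and> Re (cis (- (lam + (pi/2 - \<beta>))) * p) > 0"
  define q s \<psi> where "q = cis (- lam) * p" and "s = cmod q" and "\<psi> = Arg q"
  have "p \<noteq> 0" using H by auto
  then have s: "s > 0" by (simp add: s_def q_def)
  have "q = of_real s * cis \<psi>" using rcis_cmod_Arg[of q] by (simp add: rcis_def s_def \<psi>_def)
  moreover have "p = cis lam * q" by (simp add: q_def cis_mult flip: mult.assoc)
  ultimately have p: "p = of_real s * cis (\<psi> + lam)"
    by (simp add: cis_mult mult.left_commute add.commute)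
  have \<psi>: "- pi < \<psi>" "\<psi> \<le> pi" using Arg_bounded[of q] by (auto simp: \<psi>_def)
  have "cos (\<psi> + lam - (lam - (pi/2 - \<beta>))) > 0" "cos (\<psi> + lam - (lam + (pi/2 - \<beta>))) > 0"
    using H s unfolding p Re_cis_mult_cis by (auto simp: zero_less_mult_iff)
  moreover have "\<psi> + lam - (lam - (pi/2 - \<beta>)) = pi/2 - (\<beta> - \<psi>)" "\<psi> + lam - (lam + (pi/2 - \<beta>)) = (\<beta> + \<psi>) - pi/2"
    by auto
  ultimately have sp: "sin (\<beta> - \<psi>) > 0" "sin (\<beta> + \<psi>) > 0"
    by (simp_all add: cos_diff)
  have "sin (\<beta> - \<psi>) + sin (\<beta> + \<psi>) = 2 * sin \<beta> * cos \<psi>" by (simp add: sin_add sin_diff)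
  then have "2 * sin \<beta> * cos \<psi> > 0" using sp by linarith
  moreover have "sin \<beta> > 0" using assms by (intro sin_gt_zero) auto
  ultimately have c: "cos \<psi> > 0" by (simp add: zero_less_mult_iff)
  have ab: "\<bar>\<psi>\<bar> < pi / 2"
  proof (rule ccontr)
    assume "\<not> ?thesis"
    then have "cos \<bar>\<psi>\<bar> \<le> cos (pi / 2)" using \<psi> by (intro cos_monotone_0_pi_le) auto
    then show False using c by simp
  qed
  have "\<bar>\<psi>\<bar> < \<beta>"
  proof (rule ccontr)
    assume "\<not> ?thesis"
    then consider "\<psi> \<ge> \<beta>" | "\<psi> \<le> - \<beta>" by linarith
    then show False
    proof cases
      case 1
      then have "sin (\<psi> - \<beta>) \<ge> 0" using ab assms by (intro sin_ge_zero) auto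
      then show False using sp(1) by (simp add: sin_diff algebra_simps)
    next
      case 2
      then have "sin (- (\<beta> + \<psi>)) \<ge> 0" using ab assms by (intro sin_ge_zero) auto
      then show False using sp(2) unfolding sin_minus by simp
    qed
  qed
  then show "p \<in> sector lam \<beta>" unfolding sector_def using p s
    by (intro CollectI exI[of _ s] exI[of _ "\<psi> + lam"] conjI) auto
qed

lemma norm_square_has_derivative:
  fixes \<zeta> :: "real \<Rightarrow> complex"
  assumes "(\<zeta> has_vector_derivative d) (at t)"
  shows "((\<lambda>h. (cmod (\<zeta> h))\<^sup>2) has_real_derivative 2 * Re (cnj (\<zeta> t) * d)) (at t)"
  unfolding cmod_power2
  by (rule DERIV_cong[OF DERIV_add[OF DERIV_power[OF has_field_derivative_Re[OF assms], of 2]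
        DERIV_power[OF has_field_derivative_Im[OF assms], of 2]]]) simp

text \<open>The rate of change at \<open>t = 0\<close> of the squared modulus of \<open>g\<close> along the spiral \<open>w * exp (- t * cis \<mu>)\<close>.\<close>
lemma spiral_pullback_norm_derivative:
  assumes holg: "g holomorphic_on W" and "open W" "w \<in> W"
  shows "((\<lambda>t::real. (cmod (g (w * exp (- (of_real t * cis \<mu>)))))\<^sup>2) has_real_derivative
           2 * Re (cnj (g w) * (- cis \<mu> * w * deriv g w))) (at 0)"
proof -
  have 1: "((\<lambda>t::real. w * exp (- (of_real t * cis \<mu>))) has_vector_derivative (- cis \<mu> * w)) (at 0)"
  proof -
    have "((\<lambda>z. w * exp (- (z * cis \<mu>))) has_field_derivative (- cis \<mu> * w)) (at (of_real 0))"
      by (auto intro!: derivative_eq_intros)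
    then show ?thesis by (rule has_vector_derivative_real_field)
  qed
  have 2: "(g has_field_derivative deriv g w) (at (w * exp (- (of_real 0 * cis \<mu>))))"
    using holomorphic_derivI[OF assms] by simp
  have "((g \<circ> (\<lambda>t::real. w * exp (- (of_real t * cis \<mu>)))) has_vector_derivative (- cis \<mu> * w * deriv g w)) (at 0)"
    using field_vector_diff_chain_at[OF 1 2] .
  from norm_square_has_derivative[OF this] show ?thesis by (simp add: o_def)
qed

text \<open>With \<open>w = f z\<close> and \<open>d = deriv f z\<close>: pulled back by \<open>f\<close>, the spiral through \<open>f z\<close> moves towards the
  origin exactly if the quotient \<open>z * deriv f z / f z\<close> lies in the open half plane around \<open>cis \<mu>\<close>.\<close>
lemma radial_speed:
  assumes "z \<noteq> 0" "d \<noteq> 0" "w \<noteq> 0"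
  shows "Re (cnj z * (- cis \<mu> * w / d)) =
    - ((cmod z)\<^sup>2 / (cmod (cis (- \<mu>) * (z * d / w)))\<^sup>2) * Re (cis (- \<mu>) * (z * d / w))"
proof -
  have c: "cis (- \<mu>) = inverse (cis \<mu>)" by simp
  have 1: "cnj z * (- cis \<mu> * w / d) = - (of_real ((cmod z)\<^sup>2) / (cis (- \<mu>) * (z * d / w)))"
    unfolding complex_norm_square c using assms by (simp add: field_simps)
  have 2: "Re (of_real a / P) = a / (cmod P)\<^sup>2 * Re P" for a P
    by (simp add: Re_divide')
  show ?thesis unfolding 1 uminus_complex.sel 2 by simp
qed

text \<open>It suffices to treat the image \<open>K\<close> of a closed disc, which is compact. The set of times at which the
  spiral is in \<open>K\<close> is closed, and it contains a right neighbourhood of each of its points, because the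
  lifted spiral moves towards the origin at first.\<close>
lemma spirallike_image_invariant:
  assumes holf: "f holomorphic_on ball 0 1" and f0: "f 0 = 0"
    and pos: "\<And>z. z \<in> ball 0 1 - {0} \<Longrightarrow> Re (cis (- \<mu>) * (z * deriv f z / f z)) > 0"
    and w: "w \<in> f ` ball 0 1" and t: "t \<ge> 0"
  shows "w * exp (- (of_real t * cis \<mu>)) \<in> f ` ball 0 1"
proof -
  obtain z0 where z0: "z0 \<in> ball 0 1" "w = f z0" using w by blast
  define r where "r = cmod z0"
  have r1: "r < 1" using z0 by (simp add: r_def)
  define K where "K = f ` cball 0 r"
  have sub: "cball (0::complex) r \<subseteq> ball 0 1" using r1 by auto
  have "compact K" unfolding K_def
    using holomorphic_on_imp_continuous_on[OF holf] sub
    by (intro compact_continuous_image) (auto intro: continuous_on_subset)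
  then have clK: "closed K" by (rule compact_imp_closed)
  define c where "c s = w * exp (- (of_real s * cis \<mu>))" for s :: real
  have cK0: "c 0 \<in> K" using z0 by (auto simp: c_def K_def r_def)
  have step: "\<exists>\<epsilon>>0. \<forall>h. 0 < h \<and> h < \<epsilon> \<longrightarrow> c (s + h) \<in> K" if sK: "c s \<in> K" for s
  proof -
    obtain z where z: "cmod z \<le> r" "c s = f z" using sK by (auto simp: K_def)
    have cadd: "c (s + h) = c s * exp (- (of_real h * cis \<mu>))" for h
      by (simp add: c_def exp_add[symmetric] algebra_simps)
    show ?thesis
    proof (cases "z = 0")
      case True
      then have "c s = 0" using z f0 by simp
      then have "c (s + h) = c s" for h using cadd[of h] by simp
      then show ?thesis using sK by (auto intro!: exI[of _ 1])
    next
      case False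
      have zb: "z \<in> ball 0 1" "z \<in> ball 0 1 - {0}" using z r1 False by auto
      note P = pos[OF zb(2)]
      have nz: "deriv f z \<noteq> 0" "f z \<noteq> 0" using P by auto
      obtain \<rho> where \<rho>: "\<rho> > 0" "ball z \<rho> \<subseteq> ball 0 1" "open (f ` ball z \<rho>)" "inj_on f (ball z \<rho>)"
        using has_complex_derivative_locally_invertible[OF holf zb(1) _ nz(1)] by auto
      have holf': "f holomorphic_on ball z \<rho>" using holf \<rho>(2) by (rule holomorphic_on_subset)
      obtain g where g: "g holomorphic_on f ` ball z \<rho>"
        "\<And>x. x \<in> ball z \<rho> \<Longrightarrow> deriv f x * deriv g (f x) = 1"
        "\<And>x. x \<in> ball z \<rho> \<Longrightarrow> g (f x) = x"
        using holomorphic_has_inverse[OF holf' _ \<rho>(4)] by auto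
      have zz: "z \<in> ball z \<rho>" using \<rho> by simp
      have dg: "deriv g (f z) = 1 / deriv f z" using g(2)[OF zz] nz by (simp add: field_simps)
      have D: "((\<lambda>h. (cmod (g (f z * exp (- (of_real h * cis \<mu>)))))\<^sup>2) has_real_derivative
           2 * Re (cnj z * (- cis \<mu> * f z / deriv f z))) (at 0)"
        using spiral_pullback_norm_derivative[OF g(1) \<rho>(3), of "f z" \<mu>] zz g(3)[OF zz] dg by simp
      have nzq: "(cmod z)\<^sup>2 / (cmod (cis (- \<mu>) * (z * deriv f z / f z)))\<^sup>2 > 0"
        using nz False by simp
      have "2 * Re (cnj z * (- cis \<mu> * f z / deriv f z)) < 0"
      proof -
        have "2 * (- x * q) < 0" if "x > 0" "q > 0" for x q :: real using that by simp
        from this[OF nzq P] show ?thesis unfolding radial_speed[OF False nz] .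
      qed
      from DERIV_neg_dec_right[OF D this] obtain d where d: "d > 0"
        "\<And>h. h > 0 \<Longrightarrow> h < d \<Longrightarrow> (cmod (g (f z * exp (- (of_real h * cis \<mu>)))))\<^sup>2 < (cmod z)\<^sup>2"
        using g(3)[OF zz] by auto
      have "((\<lambda>h::real. f z * exp (- (of_real h * cis \<mu>))) \<longlongrightarrow> f z * exp (- (of_real 0 * cis \<mu>))) (at_right 0)"
        by (intro tendsto_intros)
      then have "((\<lambda>h::real. f z * exp (- (of_real h * cis \<mu>))) \<longlongrightarrow> f z) (at_right 0)" by simp
      then have "eventually (\<lambda>h::real. f z * exp (- (of_real h * cis \<mu>)) \<in> f ` ball z \<rho>) (at_right 0)"
        using \<rho>(3) zz by (intro topological_tendstoD) auto
      then obtain d' where d': "d' > 0" "\<And>h. h > 0 \<Longrightarrow> h < d' \<Longrightarrow> f z * exp (- (of_real h * cis \<mu>)) \<in> f ` ball z \<rho>"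
        unfolding eventually_at_right_field by auto
      have "c (s + h) \<in> K" if h: "0 < h" "h < min d d'" for h
      proof -
        obtain x where x: "x \<in> ball z \<rho>" "f z * exp (- (of_real h * cis \<mu>)) = f x" using d'(2)[of h] h by auto
        have "(cmod x)\<^sup>2 < (cmod z)\<^sup>2" using d(2)[of h] h x g(3)[OF x(1)] by simp
        then have "cmod x < cmod z" by (rule power_less_imp_less_base) simp
        then have "x \<in> cball 0 r" using z by simp
        then show ?thesis unfolding cadd z(2) x(2) K_def by blast
      qed
      then show ?thesis using d(1) d'(1) by (intro exI[of _ "min d d'"]) auto
    qed
  qed
  have "c t \<in> K"
  proof -
    define S where "S = {s \<in> {0..t}. c s \<in> K}"
    have "continuous_on UNIV c" unfolding c_def by (intro continuous_intros)
    then have "closed (c -` K)" using clK continuous_closed_vimage continuous_on_eq_continuous_at by blast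
    moreover have "S = {0..t} \<inter> c -` K" by (auto simp: S_def)
    ultimately have "closed S" by (simp add: closed_Int)
    moreover have ne: "0 \<in> S" using cK0 t by (simp add: S_def)
    moreover have bd: "bdd_above S" by (auto simp: S_def)
    ultimately have T: "Sup S \<in> S" using closed_contains_Sup by blast
    then obtain \<epsilon> where \<epsilon>: "\<epsilon> > 0" "\<And>h. 0 < h \<Longrightarrow> h < \<epsilon> \<Longrightarrow> c (Sup S + h) \<in> K"
      using step[of "Sup S"] by (auto simp: S_def)
    have "Sup S = t"
    proof (rule ccontr)
      assume "Sup S \<noteq> t"
      then have lt: "Sup S < t" using T by (auto simp: S_def)
      define h where "h = min (\<epsilon> / 2) (t - Sup S)"
      have h: "0 < h" "h < \<epsilon>" "Sup S + h \<le> t" using \<epsilon>(1) lt by (auto simp: h_def)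
      then have "Sup S + h \<in> S" using \<epsilon>(2)[OF h(1,2)] T by (auto simp: S_def)
      then show False using cSup_upper[OF _ bd] h(1) by fastforce
    qed
    then show ?thesis using T by (simp add: S_def)
  qed
  then show ?thesis using sub by (auto simp: c_def K_def)
qed

text \<open>The Noshiro-Warschawski criterion.\<close>
lemma inj_on_convex_Re_deriv_pos:
  assumes "convex S" and der: "\<And>z. z \<in> S \<Longrightarrow> (F has_field_derivative F' z) (at z)"
    and pos: "\<And>z. z \<in> S \<Longrightarrow> Re (c * F' z) > 0"
  shows "inj_on F S"
proof (rule inj_onI, rule ccontr)
  fix a b assume ab: "a \<in> S" "b \<in> S" "F a = F b" "a \<noteq> b"
  define \<gamma> where "\<gamma> t = a + of_real t * (b - a)" for t :: real
  have \<gamma>S: "\<gamma> t \<in> S" if "0 \<le> t" "t \<le> 1" for t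
    using convexD_alt[OF assms(1) ab(1,2), of t] that by (simp add: \<gamma>_def scaleR_conv_of_real algebra_simps)
  define \<phi> where "\<phi> t = Re (c * F (\<gamma> t) / (b - a))" for t
  have "(\<phi> has_real_derivative Re (c * F' (\<gamma> t))) (at t)" if t: "0 \<le> t" "t \<le> 1" for t
  proof -
    have 1: "(\<gamma> has_vector_derivative (b - a)) (at t)"
      unfolding \<gamma>_def has_vector_derivative_def by (auto intro!: derivative_eq_intros simp: scaleR_conv_of_real)
    have "((F \<circ> \<gamma>) has_vector_derivative ((b - a) * F' (\<gamma> t))) (at t)"
      using field_vector_diff_chain_at[OF 1 der[OF \<gamma>S[OF t]]] .
    then have "((\<lambda>t. (c / (b - a)) * (F \<circ> \<gamma>) t) has_vector_derivative ((c / (b - a)) * ((b - a) * F' (\<gamma> t)))) (at t)"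
      by (rule has_vector_derivative_mult_right)
    from has_field_derivative_Re[OF this] show ?thesis using ab(4) by (simp add: \<phi>_def[abs_def])
  qed
  then have "\<exists>y. DERIV \<phi> t :> y \<and> y > 0" if "0 \<le> t" "t \<le> 1" for t
    using pos[OF \<gamma>S[OF that]] that by blast
  then have "\<phi> 0 < \<phi> 1" by (rule DERIV_pos_imp_increasing[rotated]) auto
  then show False using ab(3) by (simp add: \<phi>_def \<gamma>_def)
qed

lemma holomorphic_quotient_at_zero:
  assumes "f holomorphic_on ball 0 1" "f 0 = 0"
  shows "(\<lambda>z. if z = 0 then deriv f 0 else f z / z) holomorphic_on ball 0 1"
proof -
  have "(\<lambda>z. if z = 0 then deriv f 0 else f z / z) = (\<lambda>z. if z = 0 then deriv f 0 else (f z - f 0) / (z - 0))"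
    using assms(2) by auto
  then show ?thesis using pole_lemma_open[OF assms(1) open_ball, of 0] by simp
qed

text \<open>On the left half plane \<open>f (exp \<zeta>) = exp (F \<zeta>)\<close> with \<open>F' \<zeta> = z * deriv f z / f z\<close> at \<open>z = exp \<zeta>\<close>. So \<open>F\<close>
  is injective, and \<open>F \<zeta> - \<zeta>\<close> has period \<open>2 * pi * \<i>\<close>.\<close>
lemma strongly_spirallike_inj:
  assumes sp: "strongly_spirallike lam al f" and al: "pi * al / 2 < pi / 2"
  shows "inj_on f (ball 0 1)"
proof -
  note sp' = sp[unfolded strongly_spirallike_def]
  have holf: "f holomorphic_on ball 0 1" and f0: "f 0 = 0" and d0: "deriv f 0 \<noteq> 0" using sp' by auto
  have sec: "z * deriv f z / f z \<in> sector lam (pi * al / 2)" if "z \<in> ball 0 1" "z \<noteq> 0" for z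
    using sp' that by force
  have fnz: "f z \<noteq> 0" if "z \<in> ball 0 1" "z \<noteq> 0" for z
    using sec[OF that] by (auto simp: sector_def)
  define k where "k z = (if z = 0 then deriv f 0 else f z / z)" for z
  have holk: "k holomorphic_on ball 0 1"
    using holomorphic_quotient_at_zero[OF holf f0] by (simp add: k_def[abs_def])
  have knz: "k z \<noteq> 0" if "z \<in> ball 0 1" for z using fnz[OF that] d0 by (auto simp: k_def)
  obtain h where h: "h holomorphic_on ball 0 1" "\<And>z. z \<in> ball 0 1 \<Longrightarrow> exp (h z) = k z"
    using holomorphic_logarithm_exists[of "ball 0 1" k 0] holk knz by auto
  have fk: "f z = z * exp (h z)" if "z \<in> ball 0 1" for z using h(2)[OF that] f0 by (auto simp: k_def)
  define H where "H = {\<zeta>. Re \<zeta> < 0}"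
  have expH: "exp \<zeta> \<in> ball 0 1" "exp \<zeta> \<noteq> 0" if "\<zeta> \<in> H" for \<zeta> using that by (auto simp: H_def norm_exp_eq_Re)
  define F where "F \<zeta> = \<zeta> + h (exp \<zeta>)" for \<zeta>
  have expF: "exp (F \<zeta>) = f (exp \<zeta>)" if "\<zeta> \<in> H" for \<zeta>
    using fk[OF expH(1)[OF that]] by (simp add: F_def exp_add)
  have openH: "open H" by (simp add: H_def open_halfspace_Re_lt)
  have Fder: "(F has_field_derivative (exp \<zeta> * deriv f (exp \<zeta>) / f (exp \<zeta>))) (at \<zeta>)" if z: "\<zeta> \<in> H" for \<zeta>
  proof -
    have hd: "(h has_field_derivative deriv h (exp \<zeta>)) (at (exp \<zeta>))"
      using holomorphic_derivI[OF h(1) _ expH(1)[OF z]] by simp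
    then have 1: "(F has_field_derivative (1 + deriv h (exp \<zeta>) * exp \<zeta>)) (at \<zeta>)"
      unfolding F_def by (auto intro!: derivative_eq_intros DERIV_chain2[of h])
    then have "((\<lambda>x. exp (F x)) has_field_derivative exp (F \<zeta>) * (1 + deriv h (exp \<zeta>) * exp \<zeta>)) (at \<zeta>)"
      by (auto intro!: derivative_eq_intros)
    then have 2: "((\<lambda>x. f (exp x)) has_field_derivative exp (F \<zeta>) * (1 + deriv h (exp \<zeta>) * exp \<zeta>)) (at \<zeta>)"
      by (rule has_field_derivative_transform_within_open[OF _ openH z]) (simp add: expF)
    have 3: "((\<lambda>x. f (exp x)) has_field_derivative deriv f (exp \<zeta>) * exp \<zeta>) (at \<zeta>)"
      using holomorphic_derivI[OF holf _ expH(1)[OF z]] by (auto intro!: derivative_eq_intros DERIV_chain2[of f])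
    have "f (exp \<zeta>) * (1 + deriv h (exp \<zeta>) * exp \<zeta>) = deriv f (exp \<zeta>) * exp \<zeta>"
      using DERIV_unique[OF 2 3] expF[OF z] by simp
    then have "1 + deriv h (exp \<zeta>) * exp \<zeta> = exp \<zeta> * deriv f (exp \<zeta>) / f (exp \<zeta>)"
      using fnz[OF expH[OF z]] by (simp add: field_simps)
    then show ?thesis using 1 by simp
  qed
  have injF: "inj_on F H"
  proof (rule inj_on_convex_Re_deriv_pos[where c = "cis (- lam)"])
    show "convex H" unfolding H_def by (rule convex_halfspace_Re_lt)
    fix \<zeta> assume z: "\<zeta> \<in> H"
    from sec[OF expH[OF z]] obtain s \<phi> where s: "exp \<zeta> * deriv f (exp \<zeta>) / f (exp \<zeta>) = of_real s * cis \<phi>"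
      "s > 0" "\<bar>\<phi> - lam\<bar> < pi * al / 2" unfolding sector_def by blast
    have "\<bar>\<phi> - lam\<bar> < pi / 2" using s(3) al by linarith
    then have "cos (\<phi> - lam) > 0" by (intro cos_gt_zero_pi) linarith+
    then show "Re (cis (- lam) * (exp \<zeta> * deriv f (exp \<zeta>) / f (exp \<zeta>))) > 0"
      unfolding s(1) Re_cis_mult_cis using s(2) by simp
  qed (rule Fder)
  show ?thesis
  proof (rule inj_onI)
    fix z1 z2 assume z: "z1 \<in> ball 0 1" "z2 \<in> ball 0 1" "f z1 = f z2"
    show "z1 = z2"
    proof (cases "z1 = 0 \<or> z2 = 0")
      case True then show ?thesis using z fnz f0 by metis
    next
      case False
      define \<zeta>1 \<zeta>2 where "\<zeta>1 = Ln z1" and "\<zeta>2 = Ln z2"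
      have e: "exp \<zeta>1 = z1" "exp \<zeta>2 = z2" using False by (auto simp: \<zeta>1_def \<zeta>2_def)
      have Hs: "\<zeta>1 \<in> H" "\<zeta>2 \<in> H" using z False by (auto simp: H_def \<zeta>1_def \<zeta>2_def)
      have "exp (F \<zeta>1) = exp (F \<zeta>2)" using expF Hs e z(3) by simp
      then obtain n :: int where n: "F \<zeta>1 = F \<zeta>2 + of_real (real_of_int (2 * n) * pi) * \<i>"
        unfolding exp_eq by blast
      \<comment> \<open>The equation shifts to \<open>F \<zeta>3 = F \<zeta>1\<close> because \<open>F \<zeta> - \<zeta>\<close> depends on \<open>exp \<zeta>\<close> only.\<close>
      define \<zeta>3 where "\<zeta>3 = \<zeta>2 + of_real (real_of_int (2 * n) * pi) * \<i>"
      have e3: "exp \<zeta>3 = exp \<zeta>2" unfolding exp_eq \<zeta>3_def by blast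
      have "F \<zeta>3 = F \<zeta>1" using n e3 unfolding F_def by (simp add: \<zeta>3_def)
      moreover have "\<zeta>3 \<in> H" using Hs by (simp add: H_def \<zeta>3_def)
      ultimately have "\<zeta>3 = \<zeta>1" using injF Hs by (auto dest: inj_onD)
      then show ?thesis using e e3 by simp
    qed
  qed
qed

lemma univalent_image_of_disc_ne_UNIV:
  assumes holf: "f holomorphic_on ball 0 1" and inj: "inj_on f (ball 0 1)"
  shows "f ` ball 0 1 \<noteq> UNIV"
proof
  assume U: "f ` ball 0 1 = UNIV"
  obtain g where g: "g holomorphic_on f ` ball 0 1" "\<And>z. z \<in> ball 0 1 \<Longrightarrow> g (f z) = z"
    using holomorphic_has_inverse[OF holf open_ball inj] by metis
  have "range g \<subseteq> ball 0 1"
  proof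
    fix y assume "y \<in> range g"
    then obtain w where "y = g w" by blast
    moreover obtain z where "w = f z" "z \<in> ball 0 1" using U by (metis UNIV_I imageE)
    ultimately show "y \<in> ball 0 1" using g(2) by simp
  qed
  then have "bounded (range g)" using bounded_ball bounded_subset by blast
  then have "g constant_on UNIV" using Liouville_theorem[of g] g(1) U by simp
  then obtain c where c: "\<And>x. g x = c" unfolding constant_on_def by blast
  have "g (f 0) = 0" "g (f (1/2)) = 1/2" using g(2) by auto
  then show False using c by simp
qed

text \<open>The Schwarz lemma yields the weak inequality; it is strict because \<open>z * deriv f z / f z\<close> extends to
  a holomorphic map, open or constant, with value \<open>1\<close> at the origin, and \<open>cis (- \<mu>)\<close> has positive real part.\<close>
lemma spirallike_of_image_invariant:
  assumes holf: "f holomorphic_on ball 0 1" and inj: "inj_on f (ball 0 1)" and f0: "f 0 = 0"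
    and mu: "\<bar>\<mu>\<bar> < pi / 2"
    and inv: "\<And>w t. w \<in> f ` ball 0 1 \<Longrightarrow> t \<ge> 0 \<Longrightarrow> w * exp (- (of_real t * cis \<mu>)) \<in> f ` ball 0 1"
    and z: "z \<in> ball 0 1" "z \<noteq> 0"
  shows "Re (cis (- \<mu>) * (z * deriv f z / f z)) > 0"
proof -
  have opn: "open (f ` ball 0 1)" by (rule open_mapping_thm3[OF holf open_ball inj])
  obtain g where g: "g holomorphic_on f ` ball 0 1"
    "\<And>z. z \<in> ball 0 1 \<Longrightarrow> deriv f z * deriv g (f z) = 1" "\<And>z. z \<in> ball 0 1 \<Longrightarrow> g (f z) = z"
    using holomorphic_has_inverse[OF holf open_ball inj] by metis
  have dnz: "deriv f z \<noteq> 0" if "z \<in> ball 0 1" for z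
    using holomorphic_injective_imp_regular[OF holf open_ball inj that] .
  have fnz: "f z \<noteq> 0" if "z \<in> ball 0 1" "z \<noteq> 0" for z
    using inj_onD[OF inj, of z 0] that f0 by auto
  have ge: "Re (cis (- \<mu>) * (z * deriv f z / f z)) \<ge> 0" if z: "z \<in> ball 0 1" "z \<noteq> 0" for z
  proof (rule ccontr)
    assume neg: "\<not> ?thesis"
    have le: "(cmod (g (f z * exp (- (of_real t * cis \<mu>)))))\<^sup>2 \<le> (cmod z)\<^sup>2" if t: "t \<ge> 0" for t
    proof -
      define \<phi> where "\<phi> x = g (f x * exp (- (of_real t * cis \<mu>)))" for x
      have "(\<lambda>x. f x * exp (- (of_real t * cis \<mu>))) holomorphic_on ball 0 1"
        by (intro holomorphic_intros holf)
      from holomorphic_on_compose_gen[OF this g(1)] have "\<phi> holomorphic_on ball 0 1"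
        using inv[OF _ t] by (simp add: \<phi>_def[abs_def] o_def image_subset_iff)
      moreover have "\<phi> 0 = 0" using g(3)[of 0] f0 by (simp add: \<phi>_def)
      moreover have "cmod (\<phi> x) < 1" if "cmod x < 1" for x
      proof -
        have "f x * exp (- (of_real t * cis \<mu>)) \<in> f ` ball 0 1" using that by (intro inv t) auto
        then show ?thesis using g(3) by (auto simp: \<phi>_def)
      qed
      ultimately have "cmod (\<phi> z) \<le> cmod z" using z by (intro Schwarz_Lemma(1)) auto
      then show ?thesis by (simp add: \<phi>_def)
    qed
    have dg: "deriv g (f z) = 1 / deriv f z" using g(2)[OF z(1)] dnz[OF z(1)] by (simp add: field_simps)
    have D: "((\<lambda>h. (cmod (g (f z * exp (- (of_real h * cis \<mu>)))))\<^sup>2) has_real_derivative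
         2 * Re (cnj z * (- cis \<mu> * f z / deriv f z))) (at 0)"
      using spiral_pullback_norm_derivative[OF g(1) opn, of "f z" \<mu>] z(1) g(3)[OF z(1)] dg by simp
    have "(cmod z)\<^sup>2 / (cmod (cis (- \<mu>) * (z * deriv f z / f z)))\<^sup>2 > 0"
      using dnz[OF z(1)] fnz[OF z] z(2) by simp
    then have "0 < 2 * Re (cnj z * (- cis \<mu> * f z / deriv f z))"
    proof -
      have "2 * (- x * q) > 0" if "x > 0" "\<not> q \<ge> 0" for x q :: real using that by (simp add: mult_less_0_iff)
      from this[OF _ neg] show "(cmod z)\<^sup>2 / (cmod (cis (- \<mu>) * (z * deriv f z / f z)))\<^sup>2 > 0 \<Longrightarrow> ?thesis"
        unfolding radial_speed[OF z(2) dnz[OF z(1)] fnz[OF z]] .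
    qed
    from DERIV_pos_inc_right[OF D this] obtain d where d: "d > 0"
      "\<And>h. h > 0 \<Longrightarrow> h < d \<Longrightarrow> (cmod z)\<^sup>2 < (cmod (g (f z * exp (- (of_real h * cis \<mu>)))))\<^sup>2"
      using g(3)[OF z(1)] by auto
    have "(cmod z)\<^sup>2 < (cmod (g (f z * exp (- (of_real (d / 2) * cis \<mu>)))))\<^sup>2"
      using d(2)[of "d / 2"] d(1) by linarith
    then show False using le[of "d / 2"] d(1) by linarith
  qed
  define k where "k z = (if z = 0 then deriv f 0 else f z / z)" for z
  have holk: "k holomorphic_on ball 0 1"
    using holomorphic_quotient_at_zero[OF holf f0] by (simp add: k_def[abs_def])
  have knz: "k z \<noteq> 0" if "z \<in> ball 0 1" for z using fnz[OF that] dnz[of 0] by (auto simp: k_def)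
  define P where "P z = cis (- \<mu>) * (deriv f z / k z)" for z
  have holP: "P holomorphic_on ball 0 1" unfolding P_def
    using holk knz holf holomorphic_deriv[OF holf open_ball] by (intro holomorphic_intros) auto
  have P0: "Re (P 0) > 0" using dnz[of 0] cos_gt_zero_pi[of \<mu>] mu by (simp add: P_def k_def abs_less_iff)
  have Peq: "P z = cis (- \<mu>) * (z * deriv f z / f z)" if "z \<noteq> 0" for z
    using that by (simp add: P_def k_def)
  have Pge: "Re (P z) \<ge> 0" if "z \<in> ball 0 1" for z
    using ge[OF that] P0 Peq by (cases "z = 0") auto
  have "Re (P z) \<noteq> 0"
  proof
    assume P0': "Re (P z) = 0"
    show False
    proof (cases "P constant_on ball 0 1")
      case True
      then have "P z = P 0" using z(1) by (auto simp: constant_on_def)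
      then show False using P0 P0' by simp
    next
      case False
      have "open (P ` ball 0 1)"
        by (rule open_mapping_thm[OF holP]) (use False in auto)
      then obtain e where e: "e > 0" "ball (P z) e \<subseteq> P ` ball 0 1" using z(1) by (metis imageI open_contains_ball)
      have "P z - of_real (e / 2) \<in> ball (P z) e" using e(1) by (simp add: dist_norm)
      then obtain y where "y \<in> ball 0 1" "P z - of_real (e / 2) = P y" using e(2) by blast
      then have "Re (P z) - e / 2 \<ge> 0" using Pge[of y] by (metis Re_complex_of_real minus_complex.sel(1))
      then show False using P0' e(1) by simp
    qed
  qed
  then show ?thesis using Pge[OF z(1)] Peq[OF z(2)] by simp
qed

section \<open>Cone invariant domains as images of strongly spirallike functions\<close>

context spiral_params begin

lemma strongly_spirallike_image:
  assumes sp: "strongly_spirallike lam al f" and al: "pi * al / 2 = \<beta>"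
  shows "cone_invariant (f ` ball 0 1)" "f ` ball 0 1 \<noteq> UNIV"
proof -
  note sp' = sp[unfolded strongly_spirallike_def al]
  have holf: "f holomorphic_on ball 0 1" and f0: "f 0 = 0" using sp' by auto
  have b0: "0 < \<beta>" using lam by linarith
  have pos: "Re (cis (- mu1) * (z * deriv f z / f z)) > 0"
    "Re (cis (- mu2) * (z * deriv f z / f z)) > 0" if "z \<in> ball 0 1 - {0}" for z
  proof -
    have "(if z = 0 then 1 else z * deriv f z / f z) \<in> sector lam \<beta>" using sp' that by blast
    then have "z * deriv f z / f z \<in> sector lam \<beta>" using that by simp
    then show "Re (cis (- mu1) * (z * deriv f z / f z)) > 0"
      "Re (cis (- mu2) * (z * deriv f z / f z)) > 0"
      unfolding sector_iff_half_planes[OF b0 beta] by blast+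
  qed
  show "cone_invariant (f ` ball 0 1)" unfolding cone_invariant_def
  proof (intro ballI)
    fix w c assume w: "w \<in> f ` ball 0 1" and "c \<in> log_cone lam \<beta>"
    then obtain a b where c: "a > 0" "b > 0"
      "c = - (of_real a * cis mu1 + of_real b * cis mu2)"
      unfolding log_cone_def by blast
    have w1: "w * exp (- (of_real a * cis mu1)) \<in> f ` ball 0 1"
      by (rule spirallike_image_invariant[OF holf f0 pos(1) w]) (use c in auto)
    have "w * exp (- (of_real a * cis mu1)) * exp (- (of_real b * cis mu2)) \<in> f ` ball 0 1"
      by (rule spirallike_image_invariant[OF holf f0 pos(2) w1]) (use c in auto)
    moreover have "exp c = exp (- (of_real a * cis mu1)) * exp (- (of_real b * cis mu2))"
      unfolding c(3) exp_add[symmetric] by simp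
    ultimately show "w * exp c \<in> f ` ball 0 1" by (simp only: mult.assoc)
  qed
  show "f ` ball 0 1 \<noteq> UNIV"
    using univalent_image_of_disc_ne_UNIV[OF holf strongly_spirallike_inj[OF sp]] al beta by simp
qed

text \<open>The contraction multiplies by \<open>\<kappa> s = exp ((1 + \<i> * tan lam) * ln s)\<close>, which has modulus \<open>s\<close>, as \<open>s\<close>
  decreases from \<open>1\<close> to \<open>0\<close>.\<close>
lemma cone_invariant_contractible:
  assumes inv: "cone_invariant \<Omega>" and z: "0 \<in> \<Omega>"
  shows "contractible \<Omega>"
proof -
  define \<kappa> where "\<kappa> s = (if s = 0 then 0 else exp (of_real (ln s) * Complex 1 (tan lam)))" for s :: real
  have norm\<kappa>: "cmod (\<kappa> s) = s" if "s \<ge> 0" for s using that by (simp add: \<kappa>_def norm_exp_eq_Re)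
  have cont: "continuous_on {0..1} \<kappa>"
    unfolding continuous_on_eq_continuous_within
  proof
    fix s :: real assume s: "s \<in> {0..1}"
    show "continuous (at s within {0..1}) \<kappa>"
    proof (cases "s = 0")
      case True
      have "((\<lambda>x. x) \<longlongrightarrow> (0::real)) (at 0 within {0..1})" by (rule tendsto_ident_at)
      then have "(\<kappa> \<longlongrightarrow> 0) (at 0 within {0..1})"
        by (rule Lim_null_comparison[rotated]) (auto simp: norm\<kappa> eventually_at_filter)
      then show ?thesis using True by (simp add: continuous_within \<kappa>_def)
    next
      case False
      then have s0: "s > 0" using s by simp
      have "isCont (\<lambda>x. exp (of_real (ln x) * Complex 1 (tan lam))) s"
        using s0 by (intro continuous_intros) auto
      moreover have "\<forall>\<^sub>F x in nhds s. exp (of_real (ln x) * Complex 1 (tan lam)) = \<kappa> x"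
        using eventually_nhds_in_open[of "{0<..}" s] s0 by (auto elim!: eventually_mono simp: \<kappa>_def)
      ultimately have "isCont \<kappa> s" by (simp only: isCont_cong)
      then show ?thesis by (rule continuous_at_imp_continuous_within)
    qed
  qed
  have mem: "\<kappa> s * w \<in> \<Omega>" if s: "s \<in> {0..1}" and w: "w \<in> \<Omega>" for s w
  proof -
    consider "s = 0" | "s = 1" | "0 < s" "s < 1" using s by fastforce
    then show ?thesis
    proof cases
      case 3
      have "of_real (ln s) * Complex 1 (tan lam) = Complex (- (- ln s)) (tan lam * (- (- ln s)))"
        by (simp add: complex_eq_iff)
      also have "\<dots> \<in> log_cone lam \<beta>" using 3 by (intro spiral_dir_in_cone) simp
      finally show ?thesis using inv w 3 unfolding cone_invariant_def \<kappa>_def by (simp add: mult.commute)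
    qed (use z w in \<open>auto simp: \<kappa>_def\<close>)
  qed
  have "homotopic_with_canon (\<lambda>x. True) \<Omega> \<Omega> id (\<lambda>x. 0)"
    unfolding homotopic_with_def
  proof (intro exI conjI)
    have "continuous_on ({0..1} \<times> \<Omega>) (\<lambda>p. \<kappa> (1 - fst p) * snd p)"
      by (intro continuous_intros continuous_on_compose2[OF cont]) auto
    moreover have "(\<lambda>p. \<kappa> (1 - fst p) * snd p) \<in> {0..1} \<times> \<Omega> \<rightarrow> \<Omega>" using mem by auto
    ultimately show "continuous_map (prod_topology (top_of_set {0..1}) (top_of_set \<Omega>)) (top_of_set \<Omega>) (\<lambda>p. \<kappa> (1 - fst p) * snd p)"
      by (simp flip: subtopology_Times euclidean_product_topology)
  qed (auto simp: \<kappa>_def)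
  then show ?thesis unfolding contractible_def by blast
qed

lemma cone_invariant_imp_strongly_spirallike:
  assumes inv: "cone_invariant \<Omega>" and op: "open \<Omega>" and z: "0 \<in> \<Omega>" and nU: "\<Omega> \<noteq> UNIV"
    and al: "pi * al / 2 = \<beta>"
  shows "\<exists>f. strongly_spirallike lam al f \<and> \<Omega> = f ` ball 0 1"
proof -
  have "simply_connected \<Omega>"
    using cone_invariant_contractible[OF inv z] by (rule contractible_imp_simply_connected)
  then obtain F G where F: "F holomorphic_on \<Omega>" "G holomorphic_on ball 0 1"
    "\<And>z. z \<in> \<Omega> \<Longrightarrow> F z \<in> ball 0 1 \<and> G (F z) = z" "\<And>z. z \<in> ball 0 1 \<Longrightarrow> G z \<in> \<Omega> \<and> F (G z) = z"
    using Riemann_mapping_theorem[of \<Omega>] op z nU by blast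
  have "F 0 \<in> ball 0 1" using F(3) z by blast
  then obtain p q where p: "p (F 0) = 0" "p holomorphic_on ball 0 1" "p ` ball 0 1 \<subseteq> ball 0 1" 
    "q holomorphic_on ball 0 1" "q ` ball 0 1 \<subseteq> ball 0 1"
    "\<And>z. z \<in> ball 0 1 \<Longrightarrow> p (q z) = z" "\<And>z. z \<in> ball 0 1 \<Longrightarrow> q (p z) = z"
    using that by (rule ball_biholomorphism_exists)
  define f where "f z = G (q z)" for z
  have holf: "f holomorphic_on ball 0 1"
    using holomorphic_on_compose_gen[OF p(4) F(2) p(5)] by (simp add: f_def[abs_def] o_def)
  have q0: "q 0 = F 0" using p(7)[of "F 0"] F(3)[OF z] p(1) by simp
  have f0: "f 0 = 0" using q0 F(3)[OF z] by (simp add: f_def)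
  have inj: "inj_on f (ball 0 1)"
  proof (rule inj_on_inverseI[of _ "\<lambda>w. p (F w)"])
    fix x :: complex assume x: "x \<in> ball 0 1"
    then have "q x \<in> ball 0 1" using p(5) by blast
    then show "p (F (f x)) = x" using F(4)[of "q x"] p(6)[OF x] by (simp add: f_def)
  qed
  have img: "f ` ball 0 1 = \<Omega>"
  proof (intro equalityI subsetI)
    fix w assume "w \<in> f ` ball 0 1"
    then show "w \<in> \<Omega>" using F(4) p(5) by (auto simp: f_def)
  next
    fix w assume w: "w \<in> \<Omega>"
    then have b: "F w \<in> ball 0 1" "G (F w) = w" using F(3) by auto
    then have "f (p (F w)) = w" using p(7) by (simp add: f_def)
    moreover have "p (F w) \<in> ball 0 1" using p(3) b by blast
    ultimately show "w \<in> f ` ball 0 1" by (metis imageI)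
  qed
  have d0: "deriv f 0 \<noteq> 0" using holomorphic_injective_imp_regular[OF holf open_ball inj, of 0] by simp
  have b0: "0 < \<beta>" using lam by linarith
  have edge1: "w * exp (- (of_real t * cis mu1)) \<in> f ` ball 0 1" if "w \<in> f ` ball 0 1" "t \<ge> 0" for w t
    using cone_invariant_edges[OF inv op, of w t 0] that unfolding img by simp
  have edge2: "w * exp (- (of_real t * cis mu2)) \<in> f ` ball 0 1" if "w \<in> f ` ball 0 1" "t \<ge> 0" for w t
    using cone_invariant_edges[OF inv op, of w 0 t] that unfolding img by simp
  have mu: "\<bar>mu1\<bar> < pi / 2" "\<bar>mu2\<bar> < pi / 2"
    using lam beta unfolding abs_less_iff by linarith+
  have "strongly_spirallike lam al f" unfolding strongly_spirallike_def al
  proof (intro conjI ballI holf f0 d0)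
    show "\<not> f constant_on ball 0 1"
    proof
      assume "f constant_on ball 0 1"
      then have "f 0 = f (1/2)" by (auto simp: constant_on_def)
      then show False using inj_onD[OF inj, of 0 "1/2"] by simp
    qed
    fix z :: complex assume zb: "z \<in> ball 0 1"
    show "(if z = 0 then 1 else z * deriv f z / f z) \<in> sector lam \<beta>"
    proof (cases "z = 0")
      case True
      have "(1::complex) = of_real 1 * cis 0" by simp
      then have "(1::complex) \<in> sector lam \<beta>" unfolding sector_def using lam
        by (intro CollectI exI[of _ 1] exI[of _ 0]) auto
      then show ?thesis using True by simp
    next
      case False
      then show ?thesis
        using spirallike_of_image_invariant[OF holf inj f0 mu(1) edge1 zb False]
          spirallike_of_image_invariant[OF holf inj f0 mu(2) edge2 zb False]
        by (simp only: sector_iff_half_planes[OF b0 beta]) simp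
    qed
  qed
  then show ?thesis using img by blast
qed

end

section \<open>The radius function\<close>

lemma spiral_point_pos: "r > 0 \<Longrightarrow> spiral_point lam r \<theta> = spiral_exp lam (ln r) \<theta>"
  using spiral_point_exp[of lam "ln r" \<theta>] by simp

lemma spiral_segment_subset_iff:
  assumes c: "cos lam > 0" and r: "r > 0"
  shows "spiral_segment lam (spiral_point lam r \<theta>) \<subseteq> \<Omega> \<longleftrightarrow> 0 \<in> \<Omega> \<and> (\<forall>s<ln r. spiral_exp lam s \<theta> \<in> \<Omega>)"
proof -
  have eq: "spiral_point lam r \<theta> * exp (cis lam * of_real t) = spiral_exp lam (ln r + cos lam * t) \<theta>" for t
  proof -
    have "cis lam * of_real t = Complex (cos lam * t) (0 + tan lam * (cos lam * t))"
      using c by (simp add: complex_eq_iff tan_def)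
    then show ?thesis using spiral_exp_add[of lam "ln r" \<theta> "cos lam * t" 0] by (simp add: spiral_point_pos[OF r])
  qed
  have "{spiral_point lam r \<theta> * exp (cis lam * of_real t) | t. t < 0} = {spiral_exp lam s \<theta> | s. s < ln r}"
  proof (intro set_eqI iffI)
    fix w assume "w \<in> {spiral_point lam r \<theta> * exp (cis lam * of_real t) | t. t < 0}"
    then obtain t where "w = spiral_exp lam (ln r + cos lam * t) \<theta>" "t < 0" using eq by auto
    moreover have "cos lam * t < 0" using c \<open>t < 0\<close> by (simp add: mult_pos_neg)
    ultimately show "w \<in> {spiral_exp lam s \<theta> | s. s < ln r}" by auto
  next
    fix w assume "w \<in> {spiral_exp lam s \<theta> | s. s < ln r}"
    then obtain s where s: "w = spiral_exp lam s \<theta>" "s < ln r" by auto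
    define t where "t = (s - ln r) / cos lam"
    have "t < 0" "ln r + cos lam * t = s" using s c by (auto simp: t_def divide_neg_pos)
    then show "w \<in> {spiral_point lam r \<theta> * exp (cis lam * of_real t) | t. t < 0}"
      using eq[of t] s by (intro CollectI exI[of _ t]) simp
  qed
  then show ?thesis unfolding spiral_segment_def by auto
qed

lemma radius_fun_alt:
  assumes "cos lam > 0" "0 \<in> \<Omega>"
  shows "radius_fun lam \<Omega> \<theta> = Sup (ereal ` {r. r > 0 \<and> (\<forall>s<ln r. spiral_exp lam s \<theta> \<in> \<Omega>)})"
proof -
  have "{ereal r |r. r > 0 \<and> spiral_segment lam (spiral_point lam r \<theta>) \<subseteq> \<Omega>} =
    ereal ` {r. r > 0 \<and> (\<forall>s<ln r. spiral_exp lam s \<theta> \<in> \<Omega>)}"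
    using spiral_segment_subset_iff[OF assms(1)] assms(2) by (auto simp: image_iff)
  then show ?thesis by (simp add: radius_fun_def)
qed

lemma radius_fun_periodic:
  assumes "cos lam > 0" "0 \<in> \<Omega>"
  shows "radius_fun lam \<Omega> (\<theta> + 2 * pi * of_int k) = radius_fun lam \<Omega> \<theta>"
  by (simp add: radius_fun_alt[OF assms] spiral_exp_2pi_int)

text \<open>Where the radius function is finite, the spiral ray is in \<open>\<Omega>\<close> up to this radius, and its end point is
  not, because \<open>\<Omega>\<close> is open.\<close>
lemma radius_fun_facts:
  assumes c: "cos lam > 0" and op: "open \<Omega>" and e: "e > 0" "ball 0 e \<subseteq> \<Omega>"
    and bd: "radius_fun lam \<Omega> \<theta> \<le> ereal M"
  defines "\<rho> \<equiv> real_of_ereal (radius_fun lam \<Omega> \<theta>)"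
  shows "\<rho> \<ge> e" "\<rho> \<le> M" "\<And>s. s < ln \<rho> \<Longrightarrow> spiral_exp lam s \<theta> \<in> \<Omega>" "spiral_exp lam (ln \<rho>) \<theta> \<notin> \<Omega>"
proof -
  define S where "S = {r. r > 0 \<and> (\<forall>s<ln r. spiral_exp lam s \<theta> \<in> \<Omega>)}"
  have z: "0 \<in> \<Omega>" using e by auto
  have R: "radius_fun lam \<Omega> \<theta> = Sup (ereal ` S)" unfolding S_def using radius_fun_alt[OF c z] .
  have "e \<in> S"
  proof -
    have "spiral_exp lam s \<theta> \<in> \<Omega>" if "s < ln e" for s
    proof -
      have "exp s < e" using that e(1) by (metis exp_less_cancel_iff exp_ln)
      then show ?thesis using e(2) by (auto simp: norm_spiral_exp)
    qed
    then show ?thesis using e(1) by (simp add: S_def)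
  qed
  then have ge: "ereal e \<le> radius_fun lam \<Omega> \<theta>" unfolding R by (intro Sup_upper) auto
  have \<rho>: "radius_fun lam \<Omega> \<theta> = ereal \<rho>" unfolding \<rho>_def
    using ge bd by (cases "radius_fun lam \<Omega> \<theta>") auto
  show e\<rho>: "\<rho> \<ge> e" and "\<rho> \<le> M" using ge bd \<rho> by auto
  then have pos: "\<rho> > 0" using e by simp
  show "spiral_exp lam s \<theta> \<in> \<Omega>" if "s < ln \<rho>" for s
  proof -
    have "exp s < \<rho>" using that pos by (metis exp_less_cancel_iff exp_ln)
    then have "ereal (exp s) < Sup (ereal ` S)" unfolding R[symmetric] \<rho> by simp
    then obtain r where r: "r \<in> S" "exp s < r" by (auto simp: less_Sup_iff)
    then have "s < ln r" by (metis exp_gt_zero ln_exp ln_less_cancel_iff order.strict_trans)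
    then show ?thesis using r by (simp add: S_def)
  qed
  note below = this
  show "spiral_exp lam (ln \<rho>) \<theta> \<notin> \<Omega>"
  proof
    assume a: "spiral_exp lam (ln \<rho>) \<theta> \<in> \<Omega>"
    have "isCont (\<lambda>s. exp (of_real s + \<i> * of_real (\<theta> + tan lam * s))) (ln \<rho>)"
      by (intro continuous_intros)
    then have "((\<lambda>s. spiral_exp lam s \<theta>) \<longlongrightarrow> spiral_exp lam (ln \<rho>) \<theta>) (at (ln \<rho>))"
      by (simp add: spiral_exp_def isCont_def Complex_eq)
    then have "eventually (\<lambda>s. spiral_exp lam s \<theta> \<in> \<Omega>) (at (ln \<rho>))"
      using op a by (rule topological_tendstoD)
    then obtain d where d: "d > 0" "\<And>s. s \<noteq> ln \<rho> \<Longrightarrow> dist s (ln \<rho>) < d \<Longrightarrow> spiral_exp lam s \<theta> \<in> \<Omega>"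
      unfolding eventually_at by auto
    have "spiral_exp lam s \<theta> \<in> \<Omega>" if "s < ln \<rho> + d" for s
      using that d(2)[of s] below[of s] a by (cases s "ln \<rho>" rule: linorder_cases) (auto simp: dist_real_def)
    then have "exp (ln \<rho> + d) \<in> S" by (simp add: S_def)
    then have "ereal (exp (ln \<rho> + d)) \<le> ereal \<rho>" unfolding \<rho>[symmetric] R by (intro Sup_upper) auto
    then have "\<rho> * exp d \<le> \<rho>" using pos by (simp add: exp_add)
    moreover have "exp d > 1" using d(1) by simp
    ultimately show False using pos by (simp add: mult_le_cancel_left1)
  qed
qed

context spiral_params begin

text \<open>The condition on the radius function bounds its logarithmic derivative by \<open>B\<close> and \<open>A\<close>.\<close>
lemma slope_bound_iff: "\<bar>x + sin lam * cos lam\<bar> \<le> (cos lam)\<^sup>2 * tan \<beta> \<longleftrightarrow> B \<le> x \<and> x \<le> A"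
proof -
  have "(cos lam)\<^sup>2 * tan lam = sin lam * cos lam" using cos_pos by (simp add: tan_def power2_eq_square)
  then have "A = (cos lam)\<^sup>2 * tan \<beta> - sin lam * cos lam" "B = - ((cos lam)\<^sup>2 * tan \<beta>) - sin lam * cos lam"
    by (simp_all add: slopeA_def slopeB_def algebra_simps)
  then show ?thesis by (auto simp: abs_le_iff)
qed

lemma cone_invariant_imp_radius_condition:
  assumes inv: "cone_invariant \<Omega>" and op: "open \<Omega>" and z: "0 \<in> \<Omega>" and nU: "\<Omega> \<noteq> UNIV"
    and al: "pi * al / 2 = \<beta>"
  shows "radius_condition lam al \<Omega>"
proof -
  obtain M where M: "M > 0" "\<And>w. w \<in> \<Omega> \<Longrightarrow> cmod w \<le> M"
    using cone_invariant_bounded[OF inv nU z] unfolding bounded_pos by blast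
  have bd: "radius_fun lam \<Omega> \<theta> \<le> ereal M" for \<theta>
    unfolding radius_fun_alt[OF cos_pos(1) z]
  proof (rule Sup_least)
    fix x assume "x \<in> ereal ` {r. r > 0 \<and> (\<forall>s<ln r. spiral_exp lam s \<theta> \<in> \<Omega>)}"
    then obtain r where r: "x = ereal r" "r > 0" "\<And>s. s < ln r \<Longrightarrow> spiral_exp lam s \<theta> \<in> \<Omega>" by auto
    have "r \<le> M"
    proof (rule ccontr)
      assume "\<not> r \<le> M"
      then have "ln M < ln r" using M(1) r(2) by simp
      then obtain s where s: "ln M < s" "s < ln r" using dense by blast
      have "exp s \<le> M" using M(2)[OF r(3)[OF s(2)]] by (simp add: norm_spiral_exp)
      then show False using s(1) M(1) by (metis exp_ln exp_less_cancel_iff not_less)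
    qed
    then show "x \<le> ereal M" using r by simp
  qed
  obtain e where e: "e > 0" "ball 0 e \<subseteq> \<Omega>" using op z open_contains_ball by blast
  define R where "R \<theta> = real_of_ereal (radius_fun lam \<Omega> \<theta>)" for \<theta>
  note facts = radius_fun_facts[OF cos_pos(1) op e bd, folded R_def]
  define \<phi> where "\<phi> \<theta> = ln (R \<theta>)" for \<theta>
  have Rpos: "R \<theta> > 0" for \<theta> using facts(1)[of \<theta>] e(1) by linarith
  have R\<phi>: "R \<theta> = exp (\<phi> \<theta>)" for \<theta> using Rpos by (simp add: \<phi>_def)
  \<comment> \<open>Otherwise a point of \<open>\<Omega>\<close> on the ray at \<open>\<theta>\<close> would be moved by an
        element of the cone onto the end point of the ray at \<open>\<theta> + h\<close>.\<close>
  have low: "\<phi> (\<theta> + h) \<ge> \<phi> \<theta> + min (A * h) (B * h)" for \<theta> h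
  proof (rule ccontr)
    assume "\<not> ?thesis"
    then have "\<phi> (\<theta> + h) - \<phi> \<theta> < min (A * h) (B * h)" by linarith
    then obtain s where s: "\<phi> (\<theta> + h) - \<phi> \<theta> < s" "s < min (A * h) (B * h)" using dense by blast
    have "spiral_exp lam (\<phi> (\<theta> + h) - s) \<theta> \<in> \<Omega>"
      using facts(3)[of "\<phi> (\<theta> + h) - s" \<theta>] s(1) by (simp add: \<phi>_def)
    moreover have "Complex s (h + tan lam * s) \<in> log_cone lam \<beta>" using s(2) log_cone_iff by simp
    ultimately have "spiral_exp lam (\<phi> (\<theta> + h) - s) \<theta> * exp (Complex s (h + tan lam * s)) \<in> \<Omega>"
      using inv unfolding cone_invariant_def by blast
    then have "spiral_exp lam (\<phi> (\<theta> + h)) (\<theta> + h) \<in> \<Omega>" unfolding spiral_exp_add by simp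
    then show False using facts(4)[of "\<theta> + h"] by (simp add: \<phi>_def)
  qed
  have slope: "B * (y - x) \<le> \<phi> y - \<phi> x \<and> \<phi> y - \<phi> x \<le> A * (y - x)" if xy: "x \<le> y" for x y
  proof -
    have sg: "B * (y - x) \<le> 0" "0 \<le> A * (y - x)" "A * (x - y) \<le> 0" "0 \<le> B * (x - y)"
      using A_pos B_neg xy by (auto simp: mult_nonpos_nonneg mult_nonneg_nonpos mult_nonpos_nonpos)
    have "\<phi> x + min (A * (y - x)) (B * (y - x)) \<le> \<phi> y" "\<phi> y + min (A * (x - y)) (B * (x - y)) \<le> \<phi> x"
      using low[of x "y - x"] low[of y "x - y"] by simp_all
    then have "\<phi> x + B * (y - x) \<le> \<phi> y" "\<phi> y + A * (x - y) \<le> \<phi> x" using sg by (auto simp: min_def split: if_splits)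
    then show ?thesis by (simp add: algebra_simps)
  qed
  define L where "L = A + \<bar>B\<bar>"
  have L0: "L \<ge> 0" using A_pos by (simp add: L_def)
  have lip1: "\<bar>\<phi> y - \<phi> x\<bar> \<le> L * (y - x)" if xy: "x \<le> y" for x y
  proof -
    have "A * (y - x) \<le> L * (y - x)" "- (B * (y - x)) \<le> L * (y - x)"
      using A_pos B_neg xy by (auto simp: L_def algebra_simps intro!: mult_right_mono mult_nonneg_nonneg mult_left_mono)
    then show ?thesis using slope[OF xy] by (simp add: abs_le_iff)
  qed
  have lip: "\<bar>\<phi> x - \<phi> y\<bar> \<le> L * \<bar>x - y\<bar>" for x y
    using lip1[of x y] lip1[of y x] by (cases "x \<le> y") (auto simp: abs_minus_commute)
  have expd: "exp a - exp b \<le> M * \<bar>a - b\<bar>" if "exp a \<le> M" for a b :: real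
  proof -
    have "exp a - exp b = exp a * (1 - exp (b - a))" by (simp add: algebra_simps flip: exp_add)
    also have "\<dots> \<le> exp a * \<bar>a - b\<bar>" using exp_ge_add_one_self[of "b - a"] by (intro mult_left_mono) (linarith, simp)
    also have "\<dots> \<le> M * \<bar>a - b\<bar>" using that by (intro mult_right_mono) auto
    finally show ?thesis .
  qed
  have acR: "absolutely_continuous_fun_on 0 (2 * pi) R"
  proof (rule absolutely_continuous_dominated[where h = "\<lambda>_. 0" and K = "M * L" and a' = 0 and b' = "2 * pi"])
    show "absolutely_continuous_fun_on 0 (2 * pi) (\<lambda>_. 0)"
      unfolding absolutely_continuous_fun_on_def by (auto intro!: exI[of _ 1])
    show "M * L \<ge> 0" using M L0 by simp
    fix x y :: real assume xy: "x \<le> y"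
    have "\<bar>R y - R x\<bar> \<le> M * \<bar>\<phi> y - \<phi> x\<bar>"
      using expd[of "\<phi> y" "\<phi> x"] expd[of "\<phi> x" "\<phi> y"] facts(2)[of x] facts(2)[of y]
      unfolding R\<phi> by (simp add: abs_le_iff abs_minus_commute)
    also have "\<dots> \<le> M * (L * (y - x))" using lip1[OF xy] M(1) by (intro mult_left_mono) auto
    finally show "\<bar>R y - R x\<bar> \<le> M * L * (\<bar>0 - 0\<bar> + (y - x))" by simp
  qed auto
  have ae: "AE \<theta> in lebesgue. \<exists>D. (R has_real_derivative D) (at \<theta>) \<and>
            \<bar>D / R \<theta> + sin lam * cos lam\<bar> \<le> (cos lam)\<^sup>2 * tan (pi * al / 2)"
    using lipschitz_ae_differentiable[of \<phi> L, OF lip]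
  proof eventually_elim
    case (elim \<theta>)
    then obtain D where D: "(\<phi> has_real_derivative D) (at \<theta>)" by blast
    have "((\<lambda>x. exp (\<phi> x)) has_real_derivative exp (\<phi> \<theta>) * D) (at \<theta>)"
      using D by (auto intro!: derivative_eq_intros)
    moreover have "R = (\<lambda>x. exp (\<phi> x))" using R\<phi> by (rule ext)
    ultimately have "(R has_real_derivative R \<theta> * D) (at \<theta>)" by (metis R\<phi>)
    moreover have "B \<le> D"
    proof (rule ccontr)
      assume "\<not> B \<le> D"
      then have "((\<lambda>x. \<phi> x - B * x) has_real_derivative (D - B)) (at \<theta>)" "D - B < 0"
        using D by (auto intro!: derivative_eq_intros)
      from DERIV_neg_dec_right[OF this] obtain d where d: "d > 0"
        "\<And>h. h > 0 \<Longrightarrow> h < d \<Longrightarrow> \<phi> (\<theta> + h) - B * (\<theta> + h) < \<phi> \<theta> - B * \<theta>" by blast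
      show False using d(2)[of "d / 2"] d(1) slope[of \<theta> "\<theta> + d / 2"] by (simp add: algebra_simps)
    qed
    moreover have "D \<le> A"
    proof (rule ccontr)
      assume "\<not> D \<le> A"
      then have "((\<lambda>x. \<phi> x - A * x) has_real_derivative (D - A)) (at \<theta>)" "0 < D - A"
        using D by (auto intro!: derivative_eq_intros)
      from DERIV_pos_inc_right[OF this] obtain d where d: "d > 0"
        "\<And>h. h > 0 \<Longrightarrow> h < d \<Longrightarrow> \<phi> \<theta> - A * \<theta> < \<phi> (\<theta> + h) - A * (\<theta> + h)" by blast
      show False using d(2)[of "d / 2"] d(1) slope[of \<theta> "\<theta> + d / 2"] by (simp add: algebra_simps)
    qed
    ultimately show ?case
      using Rpos[of \<theta>] slope_bound_iff[of D] al by (intro exI[of _ "R \<theta> * D"]) simp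
  qed
  show ?thesis unfolding radius_condition_def Let_def
    using bd acR ae unfolding R_def[abs_def] by blast
qed

lemma radius_condition_imp_cone_invariant:
  assumes rc: "radius_condition lam al \<Omega>" and op: "open \<Omega>" and conn: "connected \<Omega>" and z: "0 \<in> \<Omega>"
    and al: "pi * al / 2 = \<beta>"
  shows "cone_invariant \<Omega>" "\<Omega> \<noteq> UNIV"
proof -
  define R where "R \<theta> = real_of_ereal (radius_fun lam \<Omega> \<theta>)" for \<theta>
  obtain M where bd: "\<And>\<theta>. radius_fun lam \<Omega> \<theta> \<le> ereal M"
    using rc unfolding radius_condition_def Let_def by blast
  have acR: "absolutely_continuous_fun_on 0 (2 * pi) R"
    using rc unfolding radius_condition_def Let_def R_def[abs_def] by blast
  have ae: "AE \<theta> in lebesgue. \<exists>D. (R has_real_derivative D) (at \<theta>) \<and> B \<le> D / R \<theta> \<and> D / R \<theta> \<le> A"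
    using rc unfolding radius_condition_def Let_def R_def[abs_def] al slope_bound_iff by blast
  obtain e where e: "e > 0" "ball 0 e \<subseteq> \<Omega>" using op z open_contains_ball by blast
  note facts = radius_fun_facts[OF cos_pos(1) op e bd, folded R_def]
  define \<phi> where "\<phi> \<theta> = ln (R \<theta>)" for \<theta>
  have Rpos: "R \<theta> > 0" for \<theta> using facts(1)[of \<theta>] e(1) by linarith
  show "\<Omega> \<noteq> UNIV" using facts(4) by blast
  have per: "\<phi> (\<theta> + 2 * pi * of_int k) = \<phi> \<theta>" for \<theta> k
    using radius_fun_periodic[OF cos_pos(1) z] by (simp add: \<phi>_def R_def)
  \<comment> \<open>The radius function is at least \<open>e\<close>, so its logarithm inherits absolute continuity.\<close>
  have lndiff: "\<bar>\<phi> y - \<phi> x\<bar> \<le> \<bar>R y - R x\<bar> / e" for x y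
  proof -
    have "\<phi> y - \<phi> x \<le> \<bar>R y - R x\<bar> / e" for x y
    proof -
      have "\<phi> y - \<phi> x = ln (R y / R x)" using Rpos[of x] Rpos[of y] by (simp add: \<phi>_def ln_div)
      also have "\<dots> \<le> R y / R x - 1" using Rpos by (intro ln_le_minus_one) simp
      also have "\<dots> = (R y - R x) / R x" using Rpos[of x] by (simp add: field_simps)
      also have "\<dots> \<le> \<bar>R y - R x\<bar> / R x" using Rpos[of x] by (intro divide_right_mono) auto
      also have "\<dots> \<le> \<bar>R y - R x\<bar> / e" using facts(1)[of x] e(1) by (intro divide_left_mono) auto
      finally show ?thesis .
    qed
    from this[of x y] this[of y x] show ?thesis by (simp add: abs_le_iff abs_minus_commute)
  qed
  from AE_E3[OF ae] obtain N where N: "\<And>\<theta>. \<theta> \<in> space lebesgue - N \<Longrightarrow>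
      \<exists>D. (R has_real_derivative D) (at \<theta>) \<and> B \<le> D / R \<theta> \<and> D / R \<theta> \<le> A" "N \<in> null_sets lebesgue"
    by blast
  have negN: "negligible N" using N(2) by (simp add: negligible_iff_null_sets)
  have der: "\<exists>D. (\<phi> has_real_derivative D) (at \<theta>) \<and> B \<le> D \<and> D \<le> A" if "\<theta> \<notin> N" for \<theta>
  proof -
    obtain D where D: "(R has_real_derivative D) (at \<theta>)" "B \<le> D / R \<theta>" "D / R \<theta> \<le> A" using N(1)[of \<theta>] \<open>\<theta> \<notin> N\<close> by auto
    have "(\<phi> has_real_derivative (D / R \<theta>)) (at \<theta>)"
      unfolding \<phi>_def using D(1) Rpos[of \<theta>] by (auto intro!: derivative_eq_intros simp: field_simps)
    then show ?thesis using D by blast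
  qed
  have base: "B * (y - x) \<le> \<phi> y - \<phi> x \<and> \<phi> y - \<phi> x \<le> A * (y - x)" if xy: "0 \<le> x" "x \<le> y" "y \<le> 2 * pi" for x y
  proof -
    define K where "K = 1 / e + \<bar>A\<bar> + \<bar>B\<bar>"
    have K: "K \<ge> 0" using e by (simp add: K_def)
    have dom: "\<bar>\<phi> v - \<phi> u\<bar> + \<bar>C\<bar> * (v - u) \<le> K * (\<bar>R v - R u\<bar> + (v - u))"
      if C: "C = A \<or> C = B" and uv: "u \<le> v" for C u v
    proof -
      have "\<bar>\<phi> v - \<phi> u\<bar> \<le> (1 / e) * \<bar>R v - R u\<bar>" using lndiff by simp
      also have "\<dots> \<le> K * \<bar>R v - R u\<bar>" by (intro mult_right_mono) (auto simp: K_def)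
      finally have 1: "\<bar>\<phi> v - \<phi> u\<bar> \<le> K * \<bar>R v - R u\<bar>" .
      have "\<bar>C\<bar> \<le> K" using C e by (auto simp: K_def)
      then have "\<bar>C\<bar> * (v - u) \<le> K * (v - u)" using uv by (intro mult_right_mono) auto
      with 1 show ?thesis by (simp add: algebra_simps)
    qed
    have "\<phi> x - B * x \<le> \<phi> y - B * y"
    proof (rule absolutely_continuous_nondecreasing[OF _ xy(2) negN])
      show "absolutely_continuous_fun_on x y (\<lambda>\<theta>. \<phi> \<theta> - B * \<theta>)"
      proof (rule absolutely_continuous_dominated[OF acR K xy(1) xy(3)])
        fix u v :: real assume uv: "u \<le> v"
        have "\<bar>(\<phi> v - B * v) - (\<phi> u - B * u)\<bar> \<le> \<bar>\<phi> v - \<phi> u\<bar> + \<bar>B * (v - u)\<bar>"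
          by (simp add: algebra_simps abs_le_iff) linarith
        also have "\<bar>B * (v - u)\<bar> = \<bar>B\<bar> * (v - u)" using uv by (simp add: abs_mult)
        finally show "\<bar>(\<phi> v - B * v) - (\<phi> u - B * u)\<bar> \<le> K * (\<bar>R v - R u\<bar> + (v - u))"
          using dom[of B u v] uv by simp
      qed
      fix \<theta> assume "\<theta> \<in> {x..y} - N"
      then obtain D where "(\<phi> has_real_derivative D) (at \<theta>)" "B \<le> D" using der by blast
      then have "((\<lambda>\<theta>. \<phi> \<theta> - B * \<theta>) has_real_derivative (D - B)) (at \<theta>)" "0 \<le> D - B"
        by (auto intro!: derivative_eq_intros)
      then show "\<exists>D\<ge>0. ((\<lambda>\<theta>. \<phi> \<theta> - B * \<theta>) has_real_derivative D) (at \<theta>)" by blast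
    qed
    moreover have "A * x - \<phi> x \<le> A * y - \<phi> y"
    proof (rule absolutely_continuous_nondecreasing[OF _ xy(2) negN])
      show "absolutely_continuous_fun_on x y (\<lambda>\<theta>. A * \<theta> - \<phi> \<theta>)"
      proof (rule absolutely_continuous_dominated[OF acR K xy(1) xy(3)])
        fix u v :: real assume uv: "u \<le> v"
        have "\<bar>(A * v - \<phi> v) - (A * u - \<phi> u)\<bar> \<le> \<bar>\<phi> v - \<phi> u\<bar> + \<bar>A * (v - u)\<bar>"
          by (simp add: algebra_simps abs_le_iff) linarith
        also have "\<bar>A * (v - u)\<bar> = \<bar>A\<bar> * (v - u)" using uv by (simp add: abs_mult)
        finally show "\<bar>(A * v - \<phi> v) - (A * u - \<phi> u)\<bar> \<le> K * (\<bar>R v - R u\<bar> + (v - u))"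
          using dom[of A u v] uv by simp
      qed
      fix \<theta> assume "\<theta> \<in> {x..y} - N"
      then obtain D where "(\<phi> has_real_derivative D) (at \<theta>)" "D \<le> A" using der by blast
      then have "((\<lambda>\<theta>. A * \<theta> - \<phi> \<theta>) has_real_derivative (A - D)) (at \<theta>)" "0 \<le> A - D"
        by (auto intro!: derivative_eq_intros)
      then show "\<exists>D\<ge>0. ((\<lambda>\<theta>. A * \<theta> - \<phi> \<theta>) has_real_derivative D) (at \<theta>)" by blast
    qed
    ultimately show ?thesis by (simp add: algebra_simps)
  qed
  have shifted: "B * (y - x) \<le> \<phi> y - \<phi> x \<and> \<phi> y - \<phi> x \<le> A * (y - x)"
    if "2 * pi * of_int k \<le> x" "x \<le> y" "y \<le> 2 * pi * (of_int k + 1)" for x y and k :: int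
    using base[of "x - 2 * pi * of_int k" "y - 2 * pi * of_int k"] that
      per[of "x - 2 * pi * of_int k" k] per[of "y - 2 * pi * of_int k" k] by (simp add: algebra_simps)
  have slope: "B * (y - x) \<le> \<phi> y - \<phi> x \<and> \<phi> y - \<phi> x \<le> A * (y - x)" if xy: "x \<le> y" for x y
  proof -
    have "\<phi> x - B * x \<le> \<phi> y - B * y"
    proof (rule nondecreasing_glue[of "2 * pi" "\<lambda>\<theta>. \<phi> \<theta> - B * \<theta>", OF _ _ xy])
      fix k :: int and x y :: real
      assume "2 * pi * of_int k \<le> x" "x \<le> y" "y \<le> 2 * pi * (of_int k + 1)"
      from shifted[OF this] show "\<phi> x - B * x \<le> \<phi> y - B * y" by (simp add: algebra_simps)
    qed simp
    moreover have "A * x - \<phi> x \<le> A * y - \<phi> y"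
    proof (rule nondecreasing_glue[of "2 * pi" "\<lambda>\<theta>. A * \<theta> - \<phi> \<theta>", OF _ _ xy])
      fix k :: int and x y :: real
      assume "2 * pi * of_int k \<le> x" "x \<le> y" "y \<le> 2 * pi * (of_int k + 1)"
      from shifted[OF this] show "A * x - \<phi> x \<le> A * y - \<phi> y" by (simp add: algebra_simps)
    qed simp
    ultimately show ?thesis by (simp add: algebra_simps)
  qed
  have low: "\<phi> (\<theta> + h) \<ge> \<phi> \<theta> + min (A * h) (B * h)" for \<theta> h
    using slope[of \<theta> "\<theta> + h"] slope[of "\<theta> + h" \<theta>] by (cases "h \<ge> 0") (auto simp: min_le_iff_disj algebra_simps)
  have cont: "continuous_on UNIV \<phi>"
  proof (rule lipschitz_on_continuous_on[of "A + \<bar>B\<bar>"], rule lipschitz_onI)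
    fix x y :: real
    have "\<bar>\<phi> v - \<phi> u\<bar> \<le> (A + \<bar>B\<bar>) * (v - u)" if "u \<le> v" for u v
    proof -
      have "A * (v - u) \<le> (A + \<bar>B\<bar>) * (v - u)" "- (B * (v - u)) \<le> (A + \<bar>B\<bar>) * (v - u)"
        using A_pos B_neg that by (auto simp: algebra_simps intro!: mult_right_mono mult_nonneg_nonneg mult_left_mono)
      then show ?thesis using slope[OF that] by (simp add: abs_le_iff)
    qed
    from this[of x y] this[of y x] show "dist (\<phi> x) (\<phi> y) \<le> (A + \<bar>B\<bar>) * dist x y"
      by (cases "x \<le> y") (auto simp: dist_real_def abs_minus_commute)
  qed (use A_pos in auto)
  \<comment> \<open>The regions below and above the graph of \<open>\<phi>\<close>, in the logarithmic plane.\<close>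
  define lo hi where "lo = {c. Re c < \<phi> (Im c - tan lam * Re c)}" and "hi = {c. \<phi> (Im c - tan lam * Re c) < Re c}"
  have c\<phi>: "continuous_on UNIV (\<lambda>c. \<phi> (Im c - tan lam * Re c))"
    by (rule continuous_on_compose2[OF cont]) (auto intro!: continuous_intros)
  have "open lo" "open hi" unfolding lo_def hi_def
    by (intro open_Collect_less c\<phi> continuous_intros)+
  moreover have "\<not> exp constant_on (UNIV :: complex set)"
  proof
    assume "exp constant_on (UNIV :: complex set)"
    then obtain c :: complex where c: "\<And>x. exp x = c" unfolding constant_on_def by auto
    have "exp 0 = exp (\<i> * of_real pi)" using c by simp
    then show False by simp
  qed
  ultimately have opn: "open (exp ` lo)" "open (exp ` hi)"
    using open_mapping_thm[of exp UNIV] by (auto simp: holomorphic_on_exp)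
  have in_lo: "spiral_exp lam s \<theta> \<in> exp ` lo" if "s < \<phi> \<theta>" for s \<theta>
    using that by (auto simp: lo_def spiral_exp_def intro!: imageI)
  have in_hi: "spiral_exp lam s \<theta> \<in> exp ` hi" if "\<phi> \<theta> < s" for s \<theta>
    using that by (auto simp: hi_def spiral_exp_def intro!: imageI)
  have dec: "exp c = spiral_exp lam (Re c) (Im c - tan lam * Re c)" for c
    by (simp add: spiral_exp_def)
  define K where "K = ball 0 e \<union> exp ` lo"
  \<comment> \<open>The origin is not a value of \<open>exp\<close>, so the disc is needed to make \<open>K\<close> a neighbourhood of \<open>0\<close>.\<close>
  have ballK: "w \<in> exp ` lo" if w: "w \<in> ball 0 e" "w \<noteq> 0" for w
  proof -
    obtain \<theta> where \<theta>: "w = spiral_exp lam (ln (cmod w)) \<theta>" using spiral_exp_surj[OF w(2)] by blast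
    have "ln (cmod w) < \<phi> \<theta>" unfolding \<phi>_def using w facts(1)[of \<theta>] Rpos[of \<theta>] by simp
    then show ?thesis using in_lo \<theta> by metis
  qed
  have disj: "exp ` lo \<inter> exp ` hi = {}"
  proof (rule ccontr)
    assume "exp ` lo \<inter> exp ` hi \<noteq> {}"
    then obtain c d where cd: "c \<in> lo" "d \<in> hi" "exp c = exp d" by auto
    from spiral_exp_eqD[OF cd(3)[unfolded dec]] obtain k :: int where k:
      "Re c = Re d" "Im c - tan lam * Re c = Im d - tan lam * Re d + 2 * pi * of_int k" by blast
    have "\<phi> (Im c - tan lam * Re c) = \<phi> (Im d - tan lam * Re d)" unfolding k(2) by (rule per)
    then show False using cd(1,2) k(1) unfolding lo_def hi_def mem_Collect_eq by linarith
  qed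
  have char: "s < \<phi> \<theta>" if w: "spiral_exp lam s \<theta> \<in> \<Omega>" for s \<theta>
  proof -
    have neq: "s \<noteq> \<phi> \<theta>" if "spiral_exp lam s \<theta> \<in> \<Omega>" for s \<theta>
      using facts(4)[of \<theta>] that by (auto simp: \<phi>_def)
    have cov: "\<Omega> \<subseteq> K \<union> exp ` hi"
    proof
      fix w assume wO: "w \<in> \<Omega>"
      show "w \<in> K \<union> exp ` hi"
      proof (cases "w = 0")
        case True then show ?thesis using e by (simp add: K_def)
      next
        case False
        obtain \<theta> where \<theta>: "w = spiral_exp lam (ln (cmod w)) \<theta>" using spiral_exp_surj[OF False] by blast
        then have "ln (cmod w) \<noteq> \<phi> \<theta>" using neq wO by metis
        then have "w \<in> exp ` lo \<or> w \<in> exp ` hi" using in_lo in_hi \<theta> by (metis linorder_neqE)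
        then show ?thesis by (auto simp: K_def)
      qed
    qed
    have sep: "K \<inter> exp ` hi \<inter> \<Omega> = {}"
    proof -
      have "K \<subseteq> insert 0 (exp ` lo)" unfolding K_def using ballK by blast
      then have "x \<in> exp ` lo" if "x \<in> K" "x \<in> exp ` hi" for x
        using that by (metis exp_not_eq_zero imageE insertE subsetD)
      then show ?thesis using disj by (metis disjoint_iff IntD1 IntD2)
    qed
    have "open K" using opn by (simp add: K_def open_Un)
    moreover have "0 \<in> K \<inter> \<Omega>" using e z by (auto simp: K_def)
    ultimately have "exp ` hi \<inter> \<Omega> = {}"
      using connectedD[OF conn _ opn(2) sep cov] by blast
    then have "\<not> \<phi> \<theta> < s" using w in_hi by blast
    then show ?thesis using neq[OF w] by linarith
  qed
  show "cone_invariant \<Omega>" unfolding cone_invariant_def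
  proof (intro ballI)
    fix w c assume w: "w \<in> \<Omega>" and c: "c \<in> log_cone lam \<beta>"
    show "w * exp c \<in> \<Omega>"
    proof (cases "w = 0")
      case True then show ?thesis using z by simp
    next
      case False
      define s where "s = ln (cmod w)"
      obtain \<theta> where \<theta>: "w = spiral_exp lam s \<theta>" using spiral_exp_surj[OF False] unfolding s_def by blast
      define t h where "t = Re c" and "h = Im c - tan lam * t"
      have ceq: "c = Complex t (h + tan lam * t)" by (simp add: t_def h_def)
      have "t < min (A * h) (B * h)" using c log_cone_iff unfolding ceq by simp
      moreover have "s < \<phi> \<theta>" using char w \<theta> by blast
      ultimately have "s + t < \<phi> (\<theta> + h)" using low[of \<theta> h] by linarith
      then have "spiral_exp lam (s + t) (\<theta> + h) \<in> \<Omega>" using facts(3) by (simp add: \<phi>_def)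
      then show ?thesis unfolding \<theta> ceq spiral_exp_add .
    qed
  qed
qed

end

section \<open>The equivalence\<close>

theorem theorem2p2:
  fixes lam al :: real and \<Omega> :: "complex set"
  assumes "\<bar>lam\<bar> < pi * al / 2" and "pi * al / 2 < pi / 2"
    and "open \<Omega>" and "connected \<Omega>" and "0 \<in> \<Omega>"
  shows "let c1 = (\<exists>f. strongly_spirallike lam al f \<and> \<Omega> = f ` ball 0 1);
             c2 = radius_condition lam al \<Omega>;
             c3 = (\<forall>w\<in>frontier \<Omega>. (\<lambda>u. w * u) ` standard_domain lam al \<subseteq> \<Omega>);
             c4 = (\<forall>w\<in>\<Omega>. (\<lambda>u. w * u) ` standard_domain lam al \<subseteq> \<Omega>)
         in (c1 \<longleftrightarrow> c2) \<and> (c1 \<longrightarrow> c4) \<and> (c4 \<longrightarrow> c3) \<and>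
            (\<Omega> \<noteq> UNIV \<longrightarrow> c4 \<longrightarrow> c1) \<and>
            (\<not> bounded (- \<Omega>) \<longrightarrow> c3 \<longrightarrow> c1)"
proof -
  define \<beta> where "\<beta> = pi * al / 2"
  interpret spiral_params lam \<beta>
    using assms(1,2) by unfold_locales (auto simp: \<beta>_def)
  have al: "pi * al / 2 = \<beta>" by (simp add: \<beta>_def)
  have "al = 2 * \<beta> / pi" by (simp add: \<beta>_def)
  then have sd: "(\<lambda>u. w * u) ` standard_domain lam al \<subseteq> \<Omega> \<longleftrightarrow> (\<forall>c\<in>log_cone lam \<beta>. w * exp c \<in> \<Omega>)" for w
    using assms(5) by (auto simp: standard_domain_eq)
  have c4: "(\<forall>w\<in>\<Omega>. (\<lambda>u. w * u) ` standard_domain lam al \<subseteq> \<Omega>) \<longleftrightarrow> cone_invariant \<Omega>"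
    unfolding sd cone_invariant_def ..
  have c3: "(\<forall>w\<in>frontier \<Omega>. (\<lambda>u. w * u) ` standard_domain lam al \<subseteq> \<Omega>) \<longleftrightarrow>
      (\<forall>w\<in>frontier \<Omega>. \<forall>c\<in>log_cone lam \<beta>. w * exp c \<in> \<Omega>)"
    unfolding sd ..
  have 14: "(\<exists>f. strongly_spirallike lam al f \<and> \<Omega> = f ` ball 0 1) \<longleftrightarrow> cone_invariant \<Omega> \<and> \<Omega> \<noteq> UNIV"
    using strongly_spirallike_image[OF _ al] cone_invariant_imp_strongly_spirallike[OF _ assms(3,5) _ al] by blast
  have 24: "radius_condition lam al \<Omega> \<longleftrightarrow> cone_invariant \<Omega> \<and> \<Omega> \<noteq> UNIV"
    using radius_condition_imp_cone_invariant[OF _ assms(3-5) al]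
      cone_invariant_imp_radius_condition[OF _ assms(3,5) _ al] by blast
  have 43: "\<forall>w\<in>frontier \<Omega>. \<forall>c\<in>log_cone lam \<beta>. w * exp c \<in> \<Omega>" if "cone_invariant \<Omega>"
    using cone_invariant_frontier[OF that assms(3,5)] by blast
  have 34: "cone_invariant \<Omega> \<and> \<Omega> \<noteq> UNIV"
    if "\<not> bounded (- \<Omega>)" "\<forall>w\<in>frontier \<Omega>. \<forall>c\<in>log_cone lam \<beta>. w * exp c \<in> \<Omega>"
    using frontier_condition_imp_cone_invariant[OF assms(3-5) that(1)] that by auto
  show ?thesis
    unfolding Let_def c4 c3 14 24 using 43 34 by blast
qed

end
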